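(* For every nonempty well partial order $X$, $\mathbf{w}(M^{\diamond}(X))=\omega^{\widehat{\mathbf{o}(X)}-1}$.
   Context: A well partial order (wpo) is a partial order with no infinite bad sequence, where a sequence $x_1,x_2,\dots$ is bad if there are no $i<j$ with $x_i\le x_j$. For a wpo $X$, consider the trees of finite bad sequences and of finite antichains (sequences of pairwise incomparable elements) of $X$, ordered so that a sequence lies below its proper prefixes; both trees are well-founded. The rank of a node is $0$ if it cannot be extended, and otherwise is the least ordinal strictly greater than the ranks of its one-step extensions. The maximal order type $\mathbf{o}(X)$ is the rank of the empty sequence in the tree of bad sequences, and the width $\mathbf{w}(X)$ is the rank of the empty sequence in the tree of antichains. Equivalently, $\mathbf{o}(X)=\sup_{x\in X}(\mathbf{o}(\{y\in X: y\not\ge x\})+1)$ and $\mathbf{w}(X)=\sup_{x\in X}(\mathbf{w}(\{y\in X: y\perp x\})+1)$, where $y\perp x$ means $y,x$ are incomparable. $M^{\diamond}(X)$ is the set of finite multisets over $X$, ordered by the multiset embedding: $m\le_\diamond m'$ iff there is an injective map $f$ from (the elements with multiplicity of) $m$ to $m'$ with $x\le f(x)$ for all $x\in m$. For an ordinal $\alpha=\omega^{\alpha_1}+\dots+\omega^{\alpha_n}$ in Cantor normal form ($\alpha_1\ge\dots\ge\alpha_n$), $\widehat{\alpha}=\omega^{\alpha_1'}+\dots+\omega^{\alpha_n'}$, where $\alpha_i'=\alpha_i+1$ if $\alpha_i$ is the sum of an $\epsilon$-number (an ordinal $\epsilon$ with $\omega^\epsilon=\epsilon$) and a finite ordinal,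 and $\alpha_i'=\alpha_i$ otherwise. For an ordinal $\alpha\ge 1$, $\alpha-1$ denotes the unique $\gamma$ with $1+\gamma=\alpha$; thus $\alpha-1=\alpha$ if $\alpha$ is infinite and $\alpha-1=n-1$ if $\alpha=n<\omega$. *)

theory Defs
  imports Main "HOL-Library.Multiset"
begin

unbundle cardinal_syntax

section \<open>Ordinals\<close>

text \<open>
  Write \<open>\<kappa>\<close> for the cardinality of \<^typ>\<open>'a + nat\<close>. The type \<open>'a ordinal\<close> is the
  well-ordered set of all ordinals below the successor cardinal of \<open>\<kappa>\<close>. It contains the rank of
  every well-founded tree with at most \<open>\<kappa>\<close> nodes, and it is closed under ordinal addition,
  multiplication and exponentiation. Below it is used with \<^typ>\<open>'a\<close> the carrier type of the
  partial order, for which the trees of finite sequences over both \<^typ>\<open>'a\<close> and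
  \<^typ>\<open>'a multiset\<close> have at most \<open>\<kappa>\<close> nodes.
\<close>

typedef 'a ordinal = "Field (cardSuc |UNIV :: ('a + nat) set| )"
proof -
  have "infinite (Field (cardSuc |UNIV :: ('a + nat) set| ))"
    by (simp add: card_of_cardSuc_finite)
  then show ?thesis
    by (metis finite.emptyI ex_in_conv)
qed

lemma cardSuc_Card_order_UNIV: "Card_order (cardSuc |UNIV :: 'b set| )"
  by (rule cardSuc_Card_order[OF card_of_Card_order])

lemma Well_order_cardSuc_UNIV: "Well_order (cardSuc |UNIV :: 'b set| )"
  using cardSuc_Card_order_UNIV card_order_on_well_order_on by blast

instantiation ordinal :: (type) wellorder
begin

definition less_eq_ordinal :: "'a ordinal \<Rightarrow> 'a ordinal \<Rightarrow> bool" where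
  "less_eq_ordinal \<alpha> \<beta> \<longleftrightarrow> (Rep_ordinal \<alpha>, Rep_ordinal \<beta>) \<in> cardSuc |UNIV :: ('a + nat) set|"

definition less_ordinal :: "'a ordinal \<Rightarrow> 'a ordinal \<Rightarrow> bool" where
  "less_ordinal \<alpha> \<beta> \<longleftrightarrow> \<alpha> \<le> \<beta> \<and> \<alpha> \<noteq> \<beta>"

instance
proof
  let ?r = "cardSuc |UNIV :: ('a + nat) set|"
  have L: "linear_order_on (Field ?r) ?r" and W: "wf (?r - Id)"
    using Well_order_cardSuc_UNIV unfolding well_order_on_def by blast+
  have R: "refl_on (Field ?r) ?r" and T: "trans ?r" and A: "antisym ?r"
    and Tot: "total_on (Field ?r) ?r"
    using L unfolding linear_order_on_def partial_order_on_def preorder_on_def by blast+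
  fix x y z :: "'a ordinal"
  show refl: "x \<le> x" for x :: "'a ordinal"
    using R Rep_ordinal[of x] unfolding less_eq_ordinal_def refl_on_def by blast
  show anti: "x \<le> y \<Longrightarrow> y \<le> x \<Longrightarrow> x = y" for x y :: "'a ordinal"
    using A unfolding less_eq_ordinal_def antisym_def by (meson Rep_ordinal_inject)
  show "x \<le> y \<Longrightarrow> y \<le> z \<Longrightarrow> x \<le> z"
    using T unfolding less_eq_ordinal_def trans_def by blast
  show "x < y \<longleftrightarrow> x \<le> y \<and> \<not> y \<le> x"
    using anti refl unfolding less_ordinal_def by blast
  show "x \<le> y \<or> y \<le> x"
    using Tot R Rep_ordinal[of x] Rep_ordinal[of y]
    unfolding less_eq_ordinal_def total_on_def refl_on_def by metis
  fix P :: "'a ordinal \<Rightarrow> bool" and a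
  assume step: "\<And>x. (\<And>y. y < x \<Longrightarrow> P y) \<Longrightarrow> P x"
  have "wf (inv_image (?r - Id) (Rep_ordinal :: 'a ordinal \<Rightarrow> _))"
    by (rule wf_inv_image[OF W])
  moreover have "inv_image (?r - Id) (Rep_ordinal :: 'a ordinal \<Rightarrow> _) = {(x, y). x < y}"
    unfolding inv_image_def less_ordinal_def less_eq_ordinal_def by (auto simp: Rep_ordinal_inject)
  ultimately have "wf {(x :: 'a ordinal, y). x < y}"
    by simp
  then show "P a"
    by (induction a rule: wf_induct_rule) (use step in blast)
qed

end

text \<open>The least ordinal strictly above all members of \<open>S\<close>; it exists whenever \<open>S\<close> has at most
  \<open>\<kappa>\<close> members.\<close>

definition lsub :: "'a ordinal set \<Rightarrow> 'a ordinal" where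
  "lsub S = (LEAST \<gamma>. \<forall>\<xi>\<in>S. \<xi> < \<gamma>)"

lemma ordinal_strict_bound:
  fixes S :: "'a ordinal set"
  assumes "|S| \<le>o |UNIV :: ('a + nat) set|"
  shows "\<exists>\<gamma>. \<forall>\<xi>\<in>S. \<xi> < \<gamma>"
proof -
  let ?k = "|UNIV :: ('a + nat) set|"
  let ?r = "cardSuc ?k"
  have k: "Cinfinite ?k"
    by (simp add: cinfinite_def Field_card_of card_of_card_order_on)
  have wo: "Well_order ?r"
    by (rule Well_order_cardSuc_UNIV)
  have "|Rep_ordinal ` S| \<le>o ?k"
    using assms card_of_image ordLeq_transitive by blast
  then have small: "|Rep_ordinal ` S| <o ?r"
    using cardSuc_greater[OF card_of_Card_order] ordLeq_ordLess_trans by blast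
  have sub: "Rep_ordinal ` S \<subseteq> Field ?r"
    using Rep_ordinal by blast
  have nc: "\<not> cofinal (Rep_ordinal ` S) ?r"
  proof
    assume "cofinal (Rep_ordinal ` S) ?r"
    then have "|Rep_ordinal ` S| =o ?r"
      using regularCard_cardSuc[OF k] sub unfolding regularCard_def by blast
    then show False
      using small not_ordLess_ordIso by blast
  qed
  obtain a where a: "a \<in> Field ?r" "\<forall>b\<in>Rep_ordinal ` S. \<not> (a \<noteq> b \<and> (a, b) \<in> ?r)"
    using nc unfolding cofinal_def by blast
  have inf: "infinite (Field ?r)"
    by (simp add: card_of_cardSuc_finite)
  have "\<exists>c\<in>Field ?r. a \<noteq> c \<and> (a, c) \<in> ?r"
    using infinite_Card_order_limit[OF cardSuc_Card_order_UNIV inf a(1)] by blast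
  then obtain c where c: "c \<in> Field ?r" "a \<noteq> c" "(a, c) \<in> ?r"
    by blast
  have "\<xi> < Abs_ordinal c" if "\<xi> \<in> S" for \<xi>
  proof -
    have "\<xi> \<le> Abs_ordinal a"
    proof (rule ccontr)
      assume "\<not> \<xi> \<le> Abs_ordinal a"
      then have "Abs_ordinal a < \<xi>"
        by simp
      then have "(a, Rep_ordinal \<xi>) \<in> ?r" "a \<noteq> Rep_ordinal \<xi>"
        using a(1) unfolding less_ordinal_def less_eq_ordinal_def
        by (auto simp: Abs_ordinal_inverse Rep_ordinal_inverse)
      then show False
        using a(2) that by blast
    qed
    also have "Abs_ordinal a < Abs_ordinal c"
      using a(1) c unfolding less_ordinal_def less_eq_ordinal_def
      by (simp add: Abs_ordinal_inverse Abs_ordinal_inject)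
    finally show ?thesis .
  qed
  then show ?thesis
    by blast
qed

lemma lsub_greater:
  fixes S :: "'a ordinal set"
  assumes "|S| \<le>o |UNIV :: ('a + nat) set|" and "\<xi> \<in> S"
  shows "\<xi> < lsub S"
  using LeastI_ex[OF ordinal_strict_bound[OF assms(1)]] assms(2) unfolding lsub_def by blast

lemma lsub_least: "(\<And>\<xi>. \<xi> \<in> S \<Longrightarrow> \<xi> < \<gamma>) \<Longrightarrow> lsub S \<le> \<gamma>"
  unfolding lsub_def by (intro Least_le) blast

text \<open>Recursion equations, where an ordinal is identified with the set of smaller ordinals:
  \<open>\<alpha> + \<beta> = \<alpha> \<union> {\<alpha> + \<delta> | \<delta> < \<beta>}\<close> and
  \<open>\<alpha> * \<beta> = {\<alpha> * \<delta> + \<xi> | \<delta> < \<beta>, \<xi> < \<alpha>}\<close>.\<close>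

instantiation ordinal :: (type) "{zero, one, plus, times}"
begin

definition zero_ordinal :: "'a ordinal" where
  "zero_ordinal = (LEAST \<gamma>. True)"

definition one_ordinal :: "'a ordinal" where
  "one_ordinal = (LEAST \<gamma>. 0 < \<gamma>)"

function plus_ordinal :: "'a ordinal \<Rightarrow> 'a ordinal \<Rightarrow> 'a ordinal" where
  "plus_ordinal \<alpha> \<beta> = lsub ({..<\<alpha>} \<union> (\<lambda>\<delta>. plus_ordinal \<alpha> \<delta>) ` {..<\<beta>})"
  by auto
termination
  by (relation "inv_image {(x, y). x < y} snd") (rule wf_inv_image[OF wf], simp)

declare plus_ordinal.simps [simp del]

function times_ordinal :: "'a ordinal \<Rightarrow> 'a ordinal \<Rightarrow> 'a ordinal" where
  "times_ordinal \<alpha> \<beta> = lsub (\<Union>\<delta>\<in>{..<\<beta>}. (\<lambda>\<xi>. times_ordinal \<alpha> \<delta> + \<xi>) ` {..<\<alpha>})"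
  by auto
termination
  by (relation "inv_image {(x, y). x < y} snd") (rule wf_inv_image[OF wf], simp)

declare times_ordinal.simps [simp del]

instance ..

end

definition omega :: "'a ordinal" where
  "omega = (LEAST \<gamma>. 0 < \<gamma> \<and> (\<forall>\<delta><\<gamma>. \<delta> + 1 < \<gamma>))"

text \<open>\<open>omega_pow \<beta>\<close> is the supremum of \<open>1\<close> and all \<open>omega_pow \<delta> * omega\<close> with \<open>\<delta> < \<beta>\<close>.\<close>

function omega_pow :: "'a ordinal \<Rightarrow> 'a ordinal" where
  "omega_pow \<beta> = lsub ({0} \<union> (\<Union>\<delta>\<in>{..<\<beta>}. {..<omega_pow \<delta> * omega}))"
  by auto
termination
  by (relation "{(x, y). x < y}") (rule wf, simp)

declare omega_pow.simps [simp del]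

definition epsilon_number :: "'a ordinal \<Rightarrow> bool" where
  "epsilon_number \<epsilon> \<longleftrightarrow> omega_pow \<epsilon> = \<epsilon>"

definition omega_sum :: "'a ordinal list \<Rightarrow> 'a ordinal" where
  "omega_sum \<alpha>s = foldr (\<lambda>\<beta> \<sigma>. omega_pow \<beta> + \<sigma>) \<alpha>s 0"

definition cnf_exponents :: "'a ordinal \<Rightarrow> 'a ordinal list" where
  "cnf_exponents \<alpha> = (THE \<alpha>s. sorted_wrt (\<ge>) \<alpha>s \<and> \<alpha> = omega_sum \<alpha>s)"

definition prime_exponent :: "'a ordinal \<Rightarrow> 'a ordinal" where
  "prime_exponent \<beta> =
    (if \<exists>\<epsilon> n. epsilon_number \<epsilon> \<and> n < omega \<and> \<beta> = \<epsilon> + n then \<beta> + 1 else \<beta>)"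

definition ordinal_hat :: "'a ordinal \<Rightarrow> 'a ordinal" where
  "ordinal_hat \<alpha> = omega_sum (map prime_exponent (cnf_exponents \<alpha>))"

text \<open>The left subtraction \<open>-1 + \<alpha>\<close>, meaningful for \<open>\<alpha> \<ge> 1\<close>.\<close>

definition minus_one :: "'a ordinal \<Rightarrow> 'a ordinal" where
  "minus_one \<alpha> = (THE \<gamma>. 1 + \<gamma> = \<alpha>)"


section \<open>Well partial orders, maximal order type and width\<close>

text \<open>A partially ordered set is given by a carrier \<open>X\<close> and a relation \<open>le\<close>, of which only the
  restriction to \<open>X\<close> matters.\<close>

definition wpo_on :: "'a set \<Rightarrow> ('a \<Rightarrow> 'a \<Rightarrow> bool) \<Rightarrow> bool" where
  "wpo_on X le \<longleftrightarrow> reflp_on X le \<and> transp_on X le \<and> antisymp_on X le \<and>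
    \<not> (\<exists>x :: nat \<Rightarrow> 'a. range x \<subseteq> X \<and> (\<forall>i j. i < j \<longrightarrow> \<not> le (x i) (x j)))"

definition bad_seqs :: "'a set \<Rightarrow> ('a \<Rightarrow> 'a \<Rightarrow> bool) \<Rightarrow> 'a list set" where
  "bad_seqs X le = {s. set s \<subseteq> X \<and> sorted_wrt (\<lambda>x y. \<not> le x y) s}"

definition antichains :: "'a set \<Rightarrow> ('a \<Rightarrow> 'a \<Rightarrow> bool) \<Rightarrow> 'a list set" where
  "antichains X le = {s. set s \<subseteq> X \<and> sorted_wrt (\<lambda>x y. \<not> le x y \<and> \<not> le y x) s}"

text \<open>One-step extensions within a set of sequences: the longer sequence is the smaller node.\<close>

definition extension_rel :: "'a list set \<Rightarrow> ('a list \<times> 'a list) set" where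
  "extension_rel T = {(s @ [x], s) | s x. s \<in> T \<and> s @ [x] \<in> T}"

text \<open>The rank of a node of a well-founded relation. The type of the result is not determined by
  that of the nodes; it has to provide enough ordinals.\<close>

definition tree_rank :: "('n \<times> 'n) set \<Rightarrow> 'n \<Rightarrow> 'o ordinal" where
  "tree_rank R = wfrec R (\<lambda>f s. lsub (f ` {t. (t, s) \<in> R}))"

definition max_order_type :: "'a set \<Rightarrow> ('a \<Rightarrow> 'a \<Rightarrow> bool) \<Rightarrow> 'o ordinal" where
  "max_order_type X le = tree_rank (extension_rel (bad_seqs X le)) []"

definition width :: "'a set \<Rightarrow> ('a \<Rightarrow> 'a \<Rightarrow> bool) \<Rightarrow> 'o ordinal" where
  "width X le = tree_rank (extension_rel (antichains X le)) []"


section \<open>Finite multisets under the multiset embedding\<close>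

definition multisets_over :: "'a set \<Rightarrow> 'a multiset set" where
  "multisets_over X = {m. set_mset m \<subseteq> X}"

text \<open>The elements of a multiset with multiplicity: \<open>(x, i)\<close> is the \<open>i\<close>-th copy of \<open>x\<close>.\<close>

definition mset_copies :: "'a multiset \<Rightarrow> ('a \<times> nat) set" where
  "mset_copies m = (SIGMA x : set_mset m. {..<count m x})"

definition mset_embeds :: "('a \<Rightarrow> 'a \<Rightarrow> bool) \<Rightarrow> 'a multiset \<Rightarrow> 'a multiset \<Rightarrow> bool" where
  "mset_embeds le m m' \<longleftrightarrow>
    (\<exists>f. inj_on f (mset_copies m) \<and> f ` mset_copies m \<subseteq> mset_copies m' \<and>
      (\<forall>p\<in>mset_copies m. le (fst p) (fst (f p))))"

end

(*
  Ranks of residual sets: the rank of Y is at most alpha iff every y in Y leaves a residual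
  {z in Y. P y z} of rank at most some beta < alpha, and dually for lower bounds.

  Ordinals are handled as multisets of Cantor normal form exponents; the natural sum is then multiset
  union. A set X with o(X) = omega^a1 + ... + omega^an splits, by cutting it at a suitable bad sequence,
  into pieces of types omega^ai.

  Upper bound: if m' does not embed m + {x}, then either no element of m' is above x, or m' = m'' + {y}
  with x <= y and m'' not embedding m. For o(X) = omega^a this bounds o(M(X)) by omega^(omega^a') by
  induction on m, and products over the pieces give o(M(X)) <= omega^(hat o(X)). The width is at most
  o(M(X)), which suffices for infinite X; for finite X a multiset m' incomparable to m has a
  multiplicity smaller than that in m, and fixing this multiplicity removes a point of X.

  Lower bound: if no element of X - A is below an element of A, then M(X) contains M(A) copied along a
  bad sequence of M(X - A), and each copy can be shifted, by adding many copies of a point of A, so as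
  to be incomparable to finitely many earlier multisets. Hence w(M(X)) >= w(M(A)) * o(M(X - A)). The
  correction at epsilon-numbers comes from o(M(X)) >= o(X)^k for indecomposable o(X), witnessed by
  multisets of size k with a least element.
*)

theory Submission
  imports Defs "HOL-Library.Multiset_Order"
begin

text \<open>The ordinal arithmetic differs in the two directions. Upper bounds come from unions
  whose parts may be used in any interleaving, hence natural sums and products; lower bounds come
  from using one part after the other, hence ordinary ones. They meet because peeling off the
  smallest exponent of a normal form makes both sums agree. The shift: removing one element from a
  multiset over a set of type omega^c costs a factor omega^c, and the product stays below
  omega^(omega^c') only if c < omega^c'. With c' = c this fails exactly at epsilon-numbers. Shifting
  an epsilon-number alone would make it collide with its successor, so the shift passes on to every
  epsilon + n. The -1: moving a block past earlier multisets takes a nonempty set below it, so the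
  construction starts from a nonempty A about whose multisets only antichain rank 1 is known. Over
  one point this is optimal, since the multisets form a chain. If hat o(X) is infinite, 1 + gamma =
  hat o(X) forces gamma = hat o(X) and the loss is invisible; only finite X call for a separate
  upper bound.\<close>

section \<open>Ordinal arithmetic\<close>

lemma small_lessThan: "|{..<(\<alpha>::'a ordinal)}| \<le>o |UNIV :: ('a + nat) set|"
proof -
  let ?k = "|UNIV :: ('a + nat) set|" let ?r = "cardSuc ?k"
  have "Rep_ordinal ` {..<\<alpha>} \<subseteq> underS ?r (Rep_ordinal \<alpha>)"
    by (auto simp: underS_def less_ordinal_def less_eq_ordinal_def Rep_ordinal_inject)
  then have "|Rep_ordinal ` {..<\<alpha>}| \<le>o |underS ?r (Rep_ordinal \<alpha>)|"
    by (rule card_of_mono1)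
  also have "|underS ?r (Rep_ordinal \<alpha>)| <o ?r"
    by (rule card_of_underS[OF cardSuc_Card_order_UNIV Rep_ordinal])
  finally have "|Rep_ordinal ` {..<\<alpha>}| \<le>o ?k"
    by (simp add: cardSuc_ordLeq_ordLess[OF card_of_Card_order card_of_Card_order])
  moreover have "|{..<\<alpha>}| =o |Rep_ordinal ` {..<\<alpha>}|"
    by (rule card_of_ordIsoI[of Rep_ordinal]) (auto simp: bij_betw_def inj_on_def Rep_ordinal_inject)
  ultimately show ?thesis
    using ordIso_ordLeq_trans by blast
qed

lemma small_image:
  "|S| \<le>o |UNIV :: ('a + nat) set| \<Longrightarrow> |f ` S| \<le>o |UNIV :: ('a + nat) set|"
  using card_of_image ordLeq_transitive by blast

lemma infinite_sum_nat: "infinite (UNIV :: ('a + nat) set)"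
  by simp

lemma small_UN:
  "|I| \<le>o |UNIV :: ('a + nat) set| \<Longrightarrow> (\<And>i. i \<in> I \<Longrightarrow> |S i| \<le>o |UNIV :: ('a + nat) set| ) \<Longrightarrow>
    |\<Union>i\<in>I. S i| \<le>o |UNIV :: ('a + nat) set|"
  by (rule card_of_UNION_ordLeq_infinite[OF infinite_sum_nat]) auto

lemma small_Un:
  "|S| \<le>o |UNIV :: ('a + nat) set| \<Longrightarrow> |T| \<le>o |UNIV :: ('a + nat) set| \<Longrightarrow>
    |S \<union> T| \<le>o |UNIV :: ('a + nat) set|"
  by (rule card_of_Un_ordLeq_infinite_Field[OF _ _ _ card_of_Card_order])
    (simp_all add: Field_card_of)

lemma small_countable: "|range (f :: nat \<Rightarrow> 'b)| \<le>o |UNIV :: ('a + nat) set|"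
proof -
  have "|UNIV :: nat set| \<le>o |UNIV :: ('a + nat) set|"
    by (rule card_of_ordLeqI[of Inr]) auto
  then show ?thesis by (rule small_image)
qed

text \<open>\<open>lsub\<close> is a \<open>LEAST\<close>, hence informative only where a strict
  bound exists, which smallness guarantees. Through this criterion the recursion equations of the
  operations become usable.\<close>

lemma less_lsub_iff:
  fixes S :: "'a ordinal set"
  assumes "|S| \<le>o |UNIV :: ('a + nat) set|"
  shows "\<gamma> < lsub S \<longleftrightarrow> (\<exists>\<xi>\<in>S. \<gamma> \<le> \<xi>)"
proof
  assume "\<gamma> < lsub S"
  then show "\<exists>\<xi>\<in>S. \<gamma> \<le> \<xi>"
    using lsub_least[of S \<gamma>] by (meson leD leI)
next
  assume "\<exists>\<xi>\<in>S. \<gamma> \<le> \<xi>"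
  then show "\<gamma> < lsub S"
    using lsub_greater[OF assms] le_less_trans by blast
qed

section \<open>Membership criteria for the recursively defined operations\<close>

lemma ord_eqI: "(\<And>\<gamma>. \<gamma> < \<alpha> \<longleftrightarrow> \<gamma> < \<beta>) \<Longrightarrow> \<alpha> = (\<beta> :: 'a ordinal)"
  by (metis less_irrefl linorder_neqE)

lemma ord_leI: "(\<And>\<gamma>. \<gamma> < \<alpha> \<Longrightarrow> \<gamma> < \<beta>) \<Longrightarrow> \<alpha> \<le> (\<beta> :: 'a ordinal)"
  by (meson leI less_irrefl)

lemma less_add_ordinal_iff:
  "\<gamma> < \<alpha> + \<beta> \<longleftrightarrow> \<gamma> < \<alpha> \<or> (\<exists>\<delta><\<beta>. \<gamma> \<le> \<alpha> + \<delta>)" for \<alpha> \<beta> \<gamma> :: "'a ordinal"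
proof -
  have "|{..<\<alpha>} \<union> (+) \<alpha> ` {..<\<beta>}| \<le>o |UNIV :: ('a + nat) set|"
    by (intro small_Un small_image small_lessThan)
  then have "\<gamma> < \<alpha> + \<beta> \<longleftrightarrow> (\<exists>\<xi>\<in>{..<\<alpha>} \<union> (+) \<alpha> ` {..<\<beta>}. \<gamma> \<le> \<xi>)"
    unfolding plus_ordinal.simps[of \<alpha> \<beta>] by (rule less_lsub_iff)
  then show ?thesis
    by (auto simp: bex_Un)
qed

lemma less_times_ordinal_iff:
  "\<gamma> < \<alpha> * \<beta> \<longleftrightarrow> (\<exists>\<delta><\<beta>. \<exists>\<xi><\<alpha>. \<gamma> \<le> \<alpha> * \<delta> + \<xi>)" for \<alpha> \<beta> \<gamma> :: "'a ordinal"
proof -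
  have "|\<Union>\<delta>\<in>{..<\<beta>}. (\<lambda>\<xi>. \<alpha> * \<delta> + \<xi>) ` {..<\<alpha>}| \<le>o |UNIV :: ('a + nat) set|"
    by (intro small_UN small_image small_lessThan)
  then have "\<gamma> < \<alpha> * \<beta> \<longleftrightarrow> (\<exists>\<xi>\<in>(\<Union>\<delta>\<in>{..<\<beta>}. (\<lambda>\<xi>. \<alpha> * \<delta> + \<xi>) ` {..<\<alpha>}). \<gamma> \<le> \<xi>)"
    unfolding times_ordinal.simps[of \<alpha> \<beta>] by (rule less_lsub_iff)
  then show ?thesis by (auto simp: Bex_def)
qed

lemma zero_le_ordinal [simp]: "0 \<le> (\<alpha> :: 'a ordinal)"
  unfolding zero_ordinal_def by (rule Least_le) simp

lemma not_less_zero_ordinal [simp]: "\<not> (\<alpha> :: 'a ordinal) < 0"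
  by (simp add: not_less)

lemma zero_less_ordinal_iff: "0 < (\<alpha> :: 'a ordinal) \<longleftrightarrow> \<alpha> \<noteq> 0"
  using zero_le_ordinal le_less by (metis less_irrefl)

lemma less_omega_pow_iff:
  "\<gamma> < omega_pow \<beta> \<longleftrightarrow> \<gamma> = 0 \<or> (\<exists>\<delta><\<beta>. \<gamma> < omega_pow \<delta> * omega)" for \<beta> \<gamma> :: "'a ordinal"
proof -
  have "|{0} \<union> (\<Union>\<delta>\<in>{..<\<beta>}. {..<omega_pow \<delta> * omega})| \<le>o |UNIV :: ('a + nat) set|"
    by (intro small_Un small_UN small_lessThan) (simp add: card_of_singl_ordLeq)
  then have "\<gamma> < omega_pow \<beta> \<longleftrightarrow> (\<exists>\<xi>\<in>{0} \<union> (\<Union>\<delta>\<in>{..<\<beta>}. {..<omega_pow \<delta> * omega}). \<gamma> \<le> \<xi>)"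
    unfolding omega_pow.simps[of \<beta>] by (rule less_lsub_iff)
  then show ?thesis
    by (auto simp: Bex_def) (meson le_less_trans zero_le_ordinal order.antisym)+
qed

lemma zero_less_one_ordinal [simp]: "0 < (1 :: 'a ordinal)"
proof -
  have "\<exists>\<gamma> :: 'a ordinal. \<forall>\<xi>\<in>{0}. \<xi> < \<gamma>"
    by (rule ordinal_strict_bound) (simp add: card_of_singl_ordLeq)
  then have "\<exists>\<gamma> :: 'a ordinal. 0 < \<gamma>" by blast
  then show ?thesis unfolding one_ordinal_def by (rule LeastI_ex)
qed

lemma less_one_ordinal_iff [simp]: "(\<gamma> :: 'a ordinal) < 1 \<longleftrightarrow> \<gamma> = 0"
proof
  assume "\<gamma> < 1"
  then have "\<not> 0 < \<gamma>" unfolding one_ordinal_def by (rule not_less_Least)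
  then show "\<gamma> = 0" by (simp add: zero_less_ordinal_iff)
qed simp

lemma one_le_ordinal_iff: "1 \<le> (\<alpha> :: 'a ordinal) \<longleftrightarrow> \<alpha> \<noteq> 0"
  using less_one_ordinal_iff not_less by blast

section \<open>Addition\<close>

lemma add_strict_left_mono_ordinal: "\<beta> < \<gamma> \<Longrightarrow> \<alpha> + \<beta> < \<alpha> + \<gamma>" for \<alpha> \<beta> \<gamma> :: "'a ordinal"
  unfolding less_add_ordinal_iff[of _ \<alpha> \<gamma>] by auto

lemma add_left_less_iff_ordinal [simp]: "\<alpha> + \<beta> < \<alpha> + \<gamma> \<longleftrightarrow> \<beta> < \<gamma>" for \<alpha> \<beta> \<gamma> :: "'a ordinal"
  by (metis add_strict_left_mono_ordinal less_asym less_irrefl linorder_neqE)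

lemma add_left_le_iff_ordinal [simp]: "\<alpha> + \<beta> \<le> \<alpha> + \<gamma> \<longleftrightarrow> \<beta> \<le> \<gamma>" for \<alpha> \<beta> \<gamma> :: "'a ordinal"
  by (simp add: not_less[symmetric])

lemma add_left_cancel_ordinal [simp]: "\<alpha> + \<beta> = \<alpha> + \<gamma> \<longleftrightarrow> \<beta> = \<gamma>" for \<alpha> \<beta> \<gamma> :: "'a ordinal"
  by (simp add: order.eq_iff)

lemma le_add1_ordinal [simp]: "\<alpha> \<le> \<alpha> + \<beta>" for \<alpha> \<beta> :: "'a ordinal"
  by (rule ord_leI) (simp add: less_add_ordinal_iff)

lemma add_right_mono_ordinal: "\<alpha> \<le> \<beta> \<Longrightarrow> \<alpha> + \<gamma> \<le> \<beta> + \<gamma>" for \<alpha> \<beta> \<gamma> :: "'a ordinal"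
proof (induction \<gamma> rule: less_induct)
  case (less \<gamma>)
  show ?case
  proof (rule ord_leI)
    fix \<xi> assume "\<xi> < \<alpha> + \<gamma>"
    then show "\<xi> < \<beta> + \<gamma>"
      unfolding less_add_ordinal_iff[of _ _ \<gamma>] using less order.trans less_le_trans by meson
  qed
qed

lemma add_mono_ordinal: "\<alpha> \<le> \<beta> \<Longrightarrow> \<gamma> \<le> \<delta> \<Longrightarrow> \<alpha> + \<gamma> \<le> \<beta> + \<delta>" for \<alpha> \<beta> \<gamma> \<delta> :: "'a ordinal"
  by (meson add_right_mono_ordinal add_left_le_iff_ordinal order.trans)

instance ordinal :: (type) monoid_add
proof
  fix a b c :: "'a ordinal"
  show "a + b + c = a + (b + c)"
  proof (induction c rule: less_induct)
    case (less c)
    show ?case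
    proof (rule ord_eqI)
      fix \<gamma>
      have "\<gamma> < a + (b + c) \<longleftrightarrow> \<gamma> < a \<or> (\<exists>\<delta><b + c. \<gamma> \<le> a + \<delta>)"
        by (rule less_add_ordinal_iff)
      also have "\<dots> \<longleftrightarrow> \<gamma> < a \<or> (\<exists>\<delta><b. \<gamma> \<le> a + \<delta>) \<or> (\<exists>\<delta><c. \<gamma> \<le> a + (b + \<delta>))"
        unfolding less_add_ordinal_iff[of _ b c]
        by (metis add_left_le_iff_ordinal order.refl order.trans)
      also have "\<dots> \<longleftrightarrow> \<gamma> < a + b \<or> (\<exists>\<delta><c. \<gamma> \<le> a + b + \<delta>)"
        using less less_add_ordinal_iff[of \<gamma> a b] by metis
      also have "\<dots> \<longleftrightarrow> \<gamma> < a + b + c" by (rule less_add_ordinal_iff[symmetric])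
      finally show "\<gamma> < a + b + c \<longleftrightarrow> \<gamma> < a + (b + c)" by simp
    qed
  qed
  show "a + 0 = a"
    by (rule ord_eqI) (simp add: less_add_ordinal_iff)
  show "0 + a = a"
  proof (induction a rule: less_induct)
    case (less a)
    then show ?case
      by (intro ord_eqI) (auto simp: less_add_ordinal_iff dest: le_less_trans)
  qed
qed

lemma le_add2_ordinal [simp]: "\<beta> \<le> \<alpha> + \<beta>" for \<alpha> \<beta> :: "'a ordinal"
  using add_right_mono_ordinal[of 0 \<alpha> \<beta>] by simp

lemma less_add_one_iff [simp]: "\<gamma> < \<alpha> + 1 \<longleftrightarrow> \<gamma> \<le> \<alpha>" for \<alpha> \<gamma> :: "'a ordinal"
  by (auto simp: less_add_ordinal_iff[of _ _ 1])

lemma add_one_le_iff: "\<alpha> + 1 \<le> \<gamma> \<longleftrightarrow> \<alpha> < \<gamma>" for \<alpha> \<gamma> :: "'a ordinal"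
  by (metis less_add_one_iff not_le)

lemma add_eq_0_iff_ordinal [simp]: "\<alpha> + \<beta> = 0 \<longleftrightarrow> \<alpha> = 0 \<and> \<beta> = 0" for \<alpha> \<beta> :: "'a ordinal"
  by (metis add.right_neutral add_0 le_add1_ordinal le_add2_ordinal order.antisym zero_le_ordinal)

text \<open>Left subtraction: the least \<open>\<delta>\<close> with
  \<open>\<beta> \<le> \<alpha> + \<delta>\<close> cannot overshoot, because every smaller
  \<open>\<delta>'\<close> leaves \<open>\<alpha> + \<delta>'\<close> below
  \<open>\<beta>\<close>.\<close>

lemma le_imp_add_ordinal:
  fixes \<alpha> \<beta> :: "'a ordinal"
  assumes "\<alpha> \<le> \<beta>"
  obtains \<delta> where "\<beta> = \<alpha> + \<delta>"
proof -
  define \<delta> where "\<delta> = (LEAST \<delta>. \<beta> \<le> \<alpha> + \<delta>)"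
  have 1: "\<beta> \<le> \<alpha> + \<delta>"
    unfolding \<delta>_def by (rule LeastI[of _ \<beta>]) simp
  have "\<alpha> + \<delta> \<le> \<beta>"
  proof (rule ord_leI)
    fix \<gamma> assume "\<gamma> < \<alpha> + \<delta>"
    then consider "\<gamma> < \<alpha>" | \<delta>' where "\<delta>' < \<delta>" "\<gamma> \<le> \<alpha> + \<delta>'"
      unfolding less_add_ordinal_iff by blast
    then show "\<gamma> < \<beta>"
    proof cases
      case 2
      have "\<not> \<beta> \<le> \<alpha> + \<delta>'"
        using 2(1) unfolding \<delta>_def by (rule not_less_Least)
      then show ?thesis using 2(2) by simp
    qed (use assms in simp)
  qed
  with 1 show ?thesis using that by simp
qed

section \<open>Multiplication\<close>

lemma times_zero_ordinal [simp]: "\<alpha> * 0 = 0" for \<alpha> :: "'a ordinal"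
  by (rule ord_eqI) (simp add: less_times_ordinal_iff)

lemma times_left_mono_ordinal: "\<beta> \<le> \<gamma> \<Longrightarrow> \<alpha> * \<beta> \<le> \<alpha> * \<gamma>" for \<alpha> \<beta> \<gamma> :: "'a ordinal"
  by (rule ord_leI) (metis less_times_ordinal_iff less_le_trans)

lemma times_distrib_ordinal: "\<alpha> * (\<beta> + \<gamma>) = \<alpha> * \<beta> + \<alpha> * \<gamma>" for \<alpha> \<beta> \<gamma> :: "'a ordinal"
proof (induction \<gamma> rule: less_induct)
  case (less \<gamma>)
  show ?case
  proof (rule ord_eqI)
    fix \<xi>
    have "\<xi> < \<alpha> * (\<beta> + \<gamma>) \<longleftrightarrow> (\<exists>\<delta><\<beta> + \<gamma>. \<exists>\<eta><\<alpha>. \<xi> \<le> \<alpha> * \<delta> + \<eta>)"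
      by (rule less_times_ordinal_iff)
    also have "\<dots> \<longleftrightarrow> (\<exists>\<delta><\<beta>. \<exists>\<eta><\<alpha>. \<xi> \<le> \<alpha> * \<delta> + \<eta>) \<or> (\<exists>\<delta><\<gamma>. \<exists>\<eta><\<alpha>. \<xi> \<le> \<alpha> * (\<beta> + \<delta>) + \<eta>)"
      unfolding less_add_ordinal_iff[of _ \<beta> \<gamma>]
      by (meson add_mono_ordinal order.trans order.refl times_left_mono_ordinal)
    also have "\<dots> \<longleftrightarrow> \<xi> < \<alpha> * \<beta> \<or> (\<exists>\<delta><\<gamma>. \<exists>\<eta><\<alpha>. \<xi> \<le> \<alpha> * \<beta> + (\<alpha> * \<delta> + \<eta>))"
      using less by (metis (no_types, lifting) less_times_ordinal_iff add.assoc)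
    also have "\<dots> \<longleftrightarrow> \<xi> < \<alpha> * \<beta> + \<alpha> * \<gamma>"
      unfolding less_add_ordinal_iff[of _ "\<alpha> * \<beta>"] less_times_ordinal_iff[of _ \<alpha> \<gamma>]
      by (meson add_left_le_iff_ordinal order.trans order.refl)
    finally show "\<xi> < \<alpha> * (\<beta> + \<gamma>) \<longleftrightarrow> \<xi> < \<alpha> * \<beta> + \<alpha> * \<gamma>" .
  qed
qed

lemma times_one_ordinal [simp]: "\<alpha> * 1 = \<alpha>" for \<alpha> :: "'a ordinal"
  by (rule ord_eqI) (auto simp: less_times_ordinal_iff intro: le_less_trans)

lemma one_times_ordinal [simp]: "1 * \<alpha> = \<alpha>" for \<alpha> :: "'a ordinal"
proof (induction \<alpha> rule: less_induct)
  case (less \<alpha>)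
  then show ?case
    by (intro ord_eqI) (auto simp: less_times_ordinal_iff dest: le_less_trans)
qed

lemma times_right_mono_ordinal: "\<alpha> \<le> \<beta> \<Longrightarrow> \<alpha> * \<gamma> \<le> \<beta> * \<gamma>" for \<alpha> \<beta> \<gamma> :: "'a ordinal"
proof (induction \<gamma> rule: less_induct)
  case (less \<gamma>)
  show ?case
  proof (rule ord_leI)
    fix \<xi> assume "\<xi> < \<alpha> * \<gamma>"
    then obtain \<delta> \<eta> where "\<delta> < \<gamma>" "\<eta> < \<alpha>" "\<xi> \<le> \<alpha> * \<delta> + \<eta>"
      unfolding less_times_ordinal_iff by blast
    moreover have "\<alpha> * \<delta> + \<eta> \<le> \<beta> * \<delta> + \<eta>"
      by (rule add_right_mono_ordinal) (use less \<open>\<delta> < \<gamma>\<close> in blast)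
    ultimately show "\<xi> < \<beta> * \<gamma>"
      unfolding less_times_ordinal_iff[of _ \<beta>] using less.prems less_le_trans order.trans by meson
  qed
qed

lemma times_assoc_ordinal: "\<alpha> * \<beta> * \<gamma> = \<alpha> * (\<beta> * \<gamma>)" for \<alpha> \<beta> \<gamma> :: "'a ordinal"
proof (induction \<gamma> rule: less_induct)
  case (less \<gamma>)
  show ?case
  proof (rule ord_eqI)
    fix \<xi>
    have "\<xi> < \<alpha> * \<beta> * \<gamma> \<longleftrightarrow> (\<exists>\<delta><\<gamma>. \<exists>\<eta><\<alpha> * \<beta>. \<xi> \<le> \<alpha> * (\<beta> * \<delta>) + \<eta>)"
      using less by (metis less_times_ordinal_iff)
    also have "\<dots> \<longleftrightarrow> (\<exists>\<delta><\<gamma>. \<exists>\<delta>'<\<beta>. \<exists>\<eta><\<alpha>. \<xi> \<le> \<alpha> * (\<beta> * \<delta> + \<delta>') + \<eta>)"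
      unfolding less_times_ordinal_iff[of _ \<alpha> \<beta>] times_distrib_ordinal add.assoc
      by (meson add_left_le_iff_ordinal order.trans order.refl)
    also have "\<dots> \<longleftrightarrow> \<xi> < \<alpha> * (\<beta> * \<gamma>)"
      unfolding less_times_ordinal_iff[of _ \<alpha> "\<beta> * \<gamma>"] less_times_ordinal_iff[of _ \<beta> \<gamma>]
      by (meson add_mono_ordinal order.trans order.refl times_left_mono_ordinal)
    finally show "\<xi> < \<alpha> * \<beta> * \<gamma> \<longleftrightarrow> \<xi> < \<alpha> * (\<beta> * \<gamma>)" .
  qed
qed

section \<open>Finite ordinals and omega\<close>

primrec ordinal_of_nat :: "nat \<Rightarrow> 'a ordinal" where
  "ordinal_of_nat 0 = 0"
| "ordinal_of_nat (Suc n) = ordinal_of_nat n + 1"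

lemma less_ordinal_of_nat_iff: "\<gamma> < ordinal_of_nat n \<longleftrightarrow> (\<exists>k<n. \<gamma> = ordinal_of_nat k)"
proof (induction n)
  case (Suc n)
  then show ?case by (auto simp: le_less less_Suc_eq)
qed simp

lemma less_omega_iff: "\<gamma> < (omega :: 'a ordinal) \<longleftrightarrow> (\<exists>n. \<gamma> = ordinal_of_nat n)"
proof -
  define \<mu> :: "'a ordinal" where "\<mu> = lsub (range ordinal_of_nat)"
  have \<mu>: "\<gamma> < \<mu> \<longleftrightarrow> (\<exists>n. \<gamma> = ordinal_of_nat n)" for \<gamma>
    unfolding \<mu>_def less_lsub_iff[OF small_countable]
    by (auto simp: le_less less_ordinal_of_nat_iff)
  have "omega = \<mu>"
    unfolding omega_def
  proof (rule Least_equality)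
    show "0 < \<mu> \<and> (\<forall>\<delta><\<mu>. \<delta> + 1 < \<mu>)"
      unfolding \<mu> by (metis ordinal_of_nat.simps)
    fix \<kappa> :: "'a ordinal" assume \<kappa>: "0 < \<kappa> \<and> (\<forall>\<delta><\<kappa>. \<delta> + 1 < \<kappa>)"
    have "ordinal_of_nat n < \<kappa>" for n
      by (induction n) (use \<kappa> in auto)
    then show "\<mu> \<le> \<kappa>"
      by (intro ord_leI) (auto simp: \<mu>)
  qed
  with \<mu> show ?thesis by simp
qed

lemma ordinal_of_nat_add: "ordinal_of_nat (m + n) = ordinal_of_nat m + ordinal_of_nat n"
  by (induction n) (simp_all add: add.assoc)

lemma ordinal_of_nat_mono: "m \<le> n \<Longrightarrow> ordinal_of_nat m \<le> (ordinal_of_nat n :: 'a ordinal)"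
  by (metis le_add1_ordinal le_iff_add ordinal_of_nat_add)

lemma one_plus_ordinal_of_nat: "1 + ordinal_of_nat n = ordinal_of_nat (Suc n)"
  by (induction n) (simp_all add: add.assoc[symmetric])

lemma less_times_omega_iff: "\<gamma> < \<alpha> * omega \<longleftrightarrow> (\<exists>n. \<gamma> < \<alpha> * ordinal_of_nat n)" for \<alpha> \<gamma> :: "'a ordinal"
proof
  assume "\<gamma> < \<alpha> * omega"
  then obtain n \<xi> where "\<xi> < \<alpha>" "\<gamma> \<le> \<alpha> * ordinal_of_nat n + \<xi>"
    unfolding less_times_ordinal_iff less_omega_iff by blast
  then have "\<gamma> < \<alpha> * ordinal_of_nat (Suc n)"
    by (simp add: times_distrib_ordinal) (meson add_left_less_iff_ordinal le_less_trans)
  then show "\<exists>n. \<gamma> < \<alpha> * ordinal_of_nat n" by blast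
next
  assume "\<exists>n. \<gamma> < \<alpha> * ordinal_of_nat n"
  then obtain n where "\<gamma> < \<alpha> * ordinal_of_nat n" ..
  also have "\<dots> \<le> \<alpha> * omega"
    by (intro times_left_mono_ordinal less_imp_le) (auto simp: less_omega_iff)
  finally show "\<gamma> < \<alpha> * omega" .
qed

section \<open>Powers of omega\<close>

lemma omega_pow_pos [simp]: "0 < omega_pow \<beta>"
  by (simp add: less_omega_pow_iff)

lemma omega_pow_neq_0 [simp]: "omega_pow \<beta> \<noteq> 0"
  using omega_pow_pos[of \<beta>] by (simp add: zero_less_ordinal_iff del: omega_pow_pos)

lemma omega_pow_0 [simp]: "omega_pow 0 = 1"
  by (rule ord_eqI) (simp add: less_omega_pow_iff[of _ 0])

lemma omega_pow_times_omega_le: "\<delta> < \<beta> \<Longrightarrow> omega_pow \<delta> * omega \<le> omega_pow \<beta>"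
  by (rule ord_leI) (use less_omega_pow_iff in blast)

lemma omega_pow_times_less:
  assumes "\<delta> < \<beta>"
  shows "omega_pow \<delta> * ordinal_of_nat n < omega_pow \<beta>"
proof -
  have "omega_pow \<delta> * ordinal_of_nat n < omega_pow \<delta> * ordinal_of_nat (Suc n)"
    using add_strict_left_mono_ordinal[OF omega_pow_pos, of "omega_pow \<delta> * ordinal_of_nat n" \<delta>]
    by (simp add: times_distrib_ordinal)
  then have "omega_pow \<delta> * ordinal_of_nat n < omega_pow \<delta> * omega"
    unfolding less_times_omega_iff by blast
  with omega_pow_times_omega_le[OF assms] show ?thesis by simp
qed

lemma omega_pow_strict_mono: "\<delta> < \<beta> \<Longrightarrow> omega_pow \<delta> < omega_pow \<beta>"
  using omega_pow_times_less[of \<delta> \<beta> 1] by simp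

lemma omega_pow_less_iff [simp]: "omega_pow \<delta> < omega_pow \<beta> \<longleftrightarrow> \<delta> < \<beta>"
  by (metis less_asym less_irrefl linorder_neqE omega_pow_strict_mono)

lemma omega_pow_le_iff [simp]: "omega_pow \<delta> \<le> omega_pow \<beta> \<longleftrightarrow> \<delta> \<le> \<beta>"
  by (simp add: not_less[symmetric])

lemma le_omega_pow: "\<beta> \<le> omega_pow \<beta>"
proof (induction \<beta> rule: less_induct)
  case (less \<beta>)
  show ?case
    by (rule ord_leI) (meson less le_less_trans omega_pow_strict_mono)
qed

text \<open>Finite multiples of one smaller power are the form in which sums can be compared. The
  value 0 gets its own witness, because its clause in the recursion names no smaller
  exponent.\<close>

lemma less_omega_powE:
  assumes "\<gamma> < omega_pow \<beta>" "\<beta> \<noteq> 0"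
  obtains \<delta> n where "\<delta> < \<beta>" "\<gamma> < omega_pow \<delta> * ordinal_of_nat n"
proof (cases "\<gamma> = 0")
  case True
  show ?thesis
    by (rule that[of 0 1]) (use True assms zero_less_ordinal_iff in auto)
next
  case False
  with assms that show ?thesis
    unfolding less_omega_pow_iff[of _ \<beta>] less_times_omega_iff by blast
qed

lemma less_omega_pow_add_one_iff:
  "\<gamma> < omega_pow (\<beta> + 1) \<longleftrightarrow> (\<exists>n. \<gamma> < omega_pow \<beta> * ordinal_of_nat n)"
proof
  assume "\<gamma> < omega_pow (\<beta> + 1)"
  moreover have "\<beta> + 1 \<noteq> 0"
    by (metis add_eq_0_iff_ordinal less_irrefl zero_less_one_ordinal)
  ultimately obtain \<delta> n where "\<delta> \<le> \<beta>" "\<gamma> < omega_pow \<delta> * ordinal_of_nat n"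
    using less_omega_powE by (metis less_add_one_iff)
  then have "\<gamma> < omega_pow \<beta> * ordinal_of_nat n"
    by (meson less_le_trans omega_pow_le_iff times_right_mono_ordinal)
  then show "\<exists>n. \<gamma> < omega_pow \<beta> * ordinal_of_nat n" ..
qed (use omega_pow_times_less less_trans in \<open>metis less_add_one_iff order.refl\<close>)

text \<open>Both summands lie below finite multiples of the larger of two smaller powers, and such
  multiples add up to another one.\<close>

lemma omega_pow_add_closed:
  assumes "\<gamma> < omega_pow \<beta>" "\<eta> < omega_pow \<beta>"
  shows "\<gamma> + \<eta> < omega_pow \<beta>"
proof (cases "\<beta> = 0")
  case False
  obtain \<delta> n where 1: "\<delta> < \<beta>" "\<gamma> < omega_pow \<delta> * ordinal_of_nat n"
    using less_omega_powE[OF assms(1) False] .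
  obtain \<delta>' n' where 2: "\<delta>' < \<beta>" "\<eta> < omega_pow \<delta>' * ordinal_of_nat n'"
    using less_omega_powE[OF assms(2) False] .
  define \<mu> where "\<mu> = max \<delta> \<delta>'"
  have "\<gamma> \<le> omega_pow \<mu> * ordinal_of_nat n"
    using 1(2) times_right_mono_ordinal[of "omega_pow \<delta>" "omega_pow \<mu>" "ordinal_of_nat n"]
    by (simp add: \<mu>_def)
  moreover have "\<eta> \<le> omega_pow \<mu> * ordinal_of_nat n'"
    using 2(2) times_right_mono_ordinal[of "omega_pow \<delta>'" "omega_pow \<mu>" "ordinal_of_nat n'"]
    by (simp add: \<mu>_def)
  ultimately have "\<gamma> + \<eta> \<le> omega_pow \<mu> * ordinal_of_nat (n + n')"
    by (simp add: ordinal_of_nat_add times_distrib_ordinal add_mono_ordinal)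
  also have "\<dots> < omega_pow \<beta>"
    by (rule omega_pow_times_less) (simp add: \<mu>_def 1 2)
  finally show ?thesis .
qed (use assms in simp)

lemma add_omega_pow_absorb:
  assumes "\<gamma> < omega_pow \<beta>"
  shows "\<gamma> + omega_pow \<beta> = omega_pow \<beta>"
proof (rule order.antisym)
  show "\<gamma> + omega_pow \<beta> \<le> omega_pow \<beta>"
  proof (rule ord_leI)
    fix \<xi> assume "\<xi> < \<gamma> + omega_pow \<beta>"
    then consider "\<xi> < \<gamma>" | \<delta> where "\<delta> < omega_pow \<beta>" "\<xi> \<le> \<gamma> + \<delta>"
      unfolding less_add_ordinal_iff[of _ \<gamma>] by blast
    then show "\<xi> < omega_pow \<beta>"
    proof cases
      case 1
      then show ?thesis using assms by simp
    next
      case 2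
      then show ?thesis using omega_pow_add_closed[OF assms 2(1)] by simp
    qed
  qed
qed simp

text \<open>Turns a product of two lower bounds for ranks into a single power with added
  exponents.\<close>

lemma omega_pow_add_le: "omega_pow (\<alpha> + \<beta>) \<le> omega_pow \<alpha> * omega_pow \<beta>"
proof (induction \<beta> rule: less_induct)
  case (less \<beta>)
  have le: "omega_pow \<alpha> \<le> omega_pow \<alpha> * omega_pow \<beta>"
    using times_left_mono_ordinal[of 1 "omega_pow \<beta>" "omega_pow \<alpha>"]
    by (simp add: one_le_ordinal_iff)
  show ?case
  proof (rule ord_leI)
    fix \<gamma> assume "\<gamma> < omega_pow (\<alpha> + \<beta>)"
    then consider "\<gamma> = 0" | \<delta> where "\<delta> < \<alpha>" "\<gamma> < omega_pow \<delta> * omega"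
      | \<delta> \<beta>' where "\<beta>' < \<beta>" "\<delta> \<le> \<alpha> + \<beta>'" "\<gamma> < omega_pow \<delta> * omega"
      unfolding less_omega_pow_iff[of _ "\<alpha> + \<beta>"] less_add_ordinal_iff[of _ \<alpha> \<beta>] by blast
    then show "\<gamma> < omega_pow \<alpha> * omega_pow \<beta>"
    proof cases
      case 1
      then show ?thesis using le omega_pow_pos less_le_trans by metis
    next
      case 2
      then show ?thesis using le omega_pow_times_omega_le less_le_trans by metis
    next
      case 3
      have "omega_pow \<delta> * omega \<le> omega_pow (\<alpha> + \<beta>') * omega"
        using 3 by (intro times_right_mono_ordinal) simp
      also have "\<dots> \<le> omega_pow \<alpha> * omega_pow \<beta>' * omega"
        using 3 less by (intro times_right_mono_ordinal) simp
      also have "\<dots> \<le> omega_pow \<alpha> * omega_pow \<beta>"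
        unfolding times_assoc_ordinal
        by (intro times_left_mono_ordinal omega_pow_times_omega_le) (use 3 in simp)
      finally show ?thesis using 3 by simp
    qed
  qed
qed

section \<open>Cantor normal forms and natural sums\<close>

lemma omega_sum_Nil [simp]: "omega_sum [] = 0"
  and omega_sum_Cons [simp]: "omega_sum (\<beta> # \<alpha>s) = omega_pow \<beta> + omega_sum \<alpha>s"
  by (simp_all add: omega_sum_def)

lemma omega_sum_append [simp]: "omega_sum (\<alpha>s @ \<beta>s) = omega_sum \<alpha>s + omega_sum \<beta>s"
  by (induction \<alpha>s) (simp_all add: add.assoc)

lemma omega_sum_less: "(\<And>\<beta>. \<beta> \<in> set \<alpha>s \<Longrightarrow> \<beta> < \<gamma>) \<Longrightarrow> omega_sum \<alpha>s < omega_pow \<gamma>"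
  by (induction \<alpha>s) (simp_all add: omega_pow_add_closed)

text \<open>\<open>rev\<close> is there because \<open>sorted_list_of_multiset\<close> is ascending,
  while a normal form lists its exponents in nonincreasing order.\<close>

definition cnf_val :: "'a ordinal multiset \<Rightarrow> 'a ordinal" where
  "cnf_val M = omega_sum (rev (sorted_list_of_multiset M))"

lemma cnf_val_mset:
  assumes "sorted_wrt (\<ge>) \<alpha>s"
  shows "rev (sorted_list_of_multiset (mset \<alpha>s)) = \<alpha>s" "cnf_val (mset \<alpha>s) = omega_sum \<alpha>s"
proof -
  have "sorted (rev \<alpha>s)"
    using assms by (simp add: sorted_wrt_rev)
  then have "sort \<alpha>s = rev \<alpha>s"
    by (intro properties_for_sort) simp_all
  then show "rev (sorted_list_of_multiset (mset \<alpha>s)) = \<alpha>s" "cnf_val (mset \<alpha>s) = omega_sum \<alpha>s"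
    by (simp_all add: cnf_val_def)
qed

lemma cnf_val_empty [simp]: "cnf_val {#} = 0"
  and cnf_val_single [simp]: "cnf_val {#\<beta>#} = omega_pow \<beta>"
  by (simp_all add: cnf_val_def)

text \<open>No exponent of \<open>B\<close> exceeds one of \<open>A\<close>, so the two
  nonincreasing lists concatenate and nothing is absorbed.\<close>

lemma cnf_val_add:
  assumes "\<And>\<alpha> \<beta>. \<alpha> \<in># A \<Longrightarrow> \<beta> \<in># B \<Longrightarrow> \<beta> \<le> \<alpha>"
  shows "cnf_val (A + B) = cnf_val A + cnf_val B"
proof -
  let ?a = "rev (sorted_list_of_multiset A)" and ?b = "rev (sorted_list_of_multiset B)"
  have "sorted_wrt (\<ge>) ?a" "sorted_wrt (\<ge>) ?b"
    by (simp_all add: sorted_wrt_rev)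
  then have "sorted_wrt (\<ge>) (?a @ ?b)"
    using assms by (simp add: sorted_wrt_append)
  from cnf_val_mset(2)[OF this] show ?thesis
    by (simp add: cnf_val_def)
qed

lemma cnf_val_less_omega_powI: "(\<And>\<beta>. \<beta> \<in># M \<Longrightarrow> \<beta> < \<gamma>) \<Longrightarrow> cnf_val M < omega_pow \<gamma>"
  unfolding cnf_val_def by (rule omega_sum_less) simp

text \<open>The largest \<open>x\<close> whose multiplicities differ decides the multiset order.
  Both normal forms share the terms above \<open>x\<close> and the first \<open>i\<close> copies of
  \<open>omega_pow x\<close>; all that is left of \<open>M\<close> is smaller than the next copy,
  which only \<open>N\<close> has.\<close>

lemma cnf_val_strict_mono:
  assumes "M < N"
  shows "cnf_val M < cnf_val N"
proof -
  define D where "D = {x. count M x \<noteq> count N x}"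
  have "D \<subseteq> set_mset M \<union> set_mset N"
    unfolding D_def by (auto simp: not_in_iff)
  then have "finite D" by (rule finite_subset) simp
  moreover have "D \<noteq> {}"
    using assms unfolding D_def by (metis (mono_tags) empty_Collect_eq less_irrefl multiset_eqI)
  ultimately have x: "Max D \<in> D" "\<And>y. y \<in> D \<Longrightarrow> y \<le> Max D"
    by simp_all
  define x where "x = Max D"
  have eq: "count M y = count N y" if "x < y" for y
  proof (rule ccontr)
    assume "count M y \<noteq> count N y"
    then have "y \<in> D" by (simp add: D_def)
    then show False using x(2) that unfolding x_def by (meson leD)
  qed
  have "\<not> count N x < count M x"
    using assms eq unfolding less_multiset\<^sub>H\<^sub>O by (metis less_irrefl)
  with x(1) have less: "count M x < count N x"
    unfolding x_def D_def by auto
  define i where "i = count M x"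
  define Z where "Z = filter_mset (\<lambda>y. x < y) M"
  define J where "J = filter_mset (\<lambda>y. y < x) M"
  \<comment> \<open>One of the additional copies of \<open>x\<close> in \<open>N\<close> is kept
    apart to dominate \<open>J\<close>; the remaining ones go into \<open>K\<close>.\<close>
  define K where "K = filter_mset (\<lambda>y. y < x) N + replicate_mset (count N x - Suc i) x"
  have "M = Z + (replicate_mset i x + J)"
    unfolding Z_def J_def i_def by (rule multiset_eqI) (auto simp: not_less)
  moreover have "cnf_val (Z + (replicate_mset i x + J)) = cnf_val Z + cnf_val (replicate_mset i x + J)"
    by (rule cnf_val_add) (auto simp: Z_def J_def split: if_splits)
  moreover have "cnf_val (replicate_mset i x + J) = cnf_val (replicate_mset i x) + cnf_val J"
    by (rule cnf_val_add) (auto simp: J_def split: if_splits)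
  moreover have "cnf_val J < omega_pow x"
    by (rule cnf_val_less_omega_powI) (simp add: J_def)
  ultimately have M: "cnf_val M < cnf_val Z + (cnf_val (replicate_mset i x) + omega_pow x)"
    by simp
  have "N = Z + (replicate_mset i x + ({#x#} + K))"
    unfolding Z_def K_def i_def using less by (intro multiset_eqI) (auto simp: eq not_less)
  moreover have "cnf_val (Z + (replicate_mset i x + ({#x#} + K))) =
      cnf_val Z + cnf_val (replicate_mset i x + ({#x#} + K))"
    by (rule cnf_val_add) (auto simp: Z_def K_def split: if_splits)
  moreover have "cnf_val (replicate_mset i x + ({#x#} + K)) = cnf_val (replicate_mset i x) + cnf_val ({#x#} + K)"
    by (rule cnf_val_add) (auto simp: K_def split: if_splits)
  moreover have "cnf_val ({#x#} + K) = cnf_val {#x#} + cnf_val K"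
    by (rule cnf_val_add) (auto simp: K_def split: if_splits)
  ultimately have "cnf_val Z + (cnf_val (replicate_mset i x) + omega_pow x) \<le> cnf_val N"
    by simp
  with M show ?thesis by simp
qed

lemma cnf_val_less_iff [simp]: "cnf_val M < cnf_val N \<longleftrightarrow> M < N"
  by (metis cnf_val_strict_mono less_asym less_irrefl linorder_neqE)

lemma cnf_val_le_iff [simp]: "cnf_val M \<le> cnf_val N \<longleftrightarrow> M \<le> N"
  by (simp add: not_less[symmetric])

lemma cnf_val_eq_iff [simp]: "cnf_val M = cnf_val N \<longleftrightarrow> M = N"
  by (simp add: order.eq_iff)

lemma cnf_val_less_omega_pow_iff: "cnf_val M < omega_pow \<gamma> \<longleftrightarrow> (\<forall>\<beta>\<in>#M. \<beta> < \<gamma>)"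
proof
  assume less: "cnf_val M < omega_pow \<gamma>"
  show "\<forall>\<beta>\<in>#M. \<beta> < \<gamma>"
  proof
    fix \<beta> assume "\<beta> \<in># M"
    then have "{#\<beta>#} \<le> M"
      by (intro subset_eq_imp_le_multiset) simp
    then have "omega_pow \<beta> \<le> cnf_val M"
      by (simp flip: cnf_val_single)
    with less have "omega_pow \<beta> < omega_pow \<gamma>" by (rule le_less_trans[rotated])
    then show "\<beta> < \<gamma>" by simp
  qed
qed (use cnf_val_less_omega_powI in blast)

text \<open>Greedy expansion: the largest power of omega that is at most \<open>\<alpha>\<close> is
  split off, and the induction hypothesis treats the remainder.\<close>

lemma cnf_val_surj: "\<exists>M. cnf_val M = \<alpha>"
proof (induction \<alpha> rule: less_induct)
  case (less \<alpha>)
  show ?case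
  proof (cases "\<alpha> = 0")
    case True
    then show ?thesis by (intro exI[of _ "{#}"]) simp
  next
    case False
    define c where "c = (LEAST c. \<alpha> < omega_pow c)"
    have ex: "\<alpha> < omega_pow (\<alpha> + 1)"
      by (metis le_omega_pow less_add_one_iff order.refl less_le_trans)
    have c: "\<alpha> < omega_pow c"
      unfolding c_def by (rule LeastI, rule ex)
    with False obtain \<delta> where \<delta>: "\<delta> < c" "\<alpha> < omega_pow \<delta> * omega"
      unfolding less_omega_pow_iff[of _ c] by blast
    have "\<not> \<alpha> < omega_pow \<delta>"
      using \<delta>(1) unfolding c_def by (rule not_less_Least)
    then obtain \<alpha>' where \<alpha>': "\<alpha> = omega_pow \<delta> + \<alpha>'"
      using le_imp_add_ordinal not_less by metis
    \<comment> \<open>If the remainder did not shrink, \<open>\<alpha>\<close> would absorb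
      \<open>omega_pow \<delta>\<close> on the left arbitrarily often and so exceed all its finite
      multiples.\<close>
    have "\<alpha>' \<noteq> \<alpha>"
    proof
      assume "\<alpha>' = \<alpha>"
      then have absorb: "omega_pow \<delta> + \<alpha> = \<alpha>" using \<alpha>' by simp
      have "omega_pow \<delta> * ordinal_of_nat n + \<alpha> = \<alpha>" for n
        by (induction n) (simp_all add: times_distrib_ordinal add.assoc absorb)
      then have "omega_pow \<delta> * ordinal_of_nat n \<le> \<alpha>" for n
        by (metis le_add1_ordinal)
      then show False
        using \<delta>(2) unfolding less_times_omega_iff by (meson leD)
    qed
    moreover have "\<alpha>' \<le> \<alpha>" using \<alpha>' by simp
    ultimately have "\<alpha>' < \<alpha>" by simp
    with less obtain M where M: "cnf_val M = \<alpha>'" by blast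
    have "\<alpha> < omega_pow (\<delta> + 1)"
      using \<delta>(2) omega_pow_times_omega_le[of \<delta> "\<delta> + 1"] by simp
    with \<open>\<alpha>' < \<alpha>\<close> M have "\<forall>\<beta>\<in>#M. \<beta> < \<delta> + 1"
      by (metis cnf_val_less_omega_pow_iff less_trans)
    then have "cnf_val ({#\<delta>#} + M) = \<alpha>"
      by (subst cnf_val_add) (auto simp: M \<alpha>')
    then show ?thesis ..
  qed
qed

definition cnf :: "'a ordinal \<Rightarrow> 'a ordinal multiset" where
  "cnf = inv cnf_val"

lemma cnf_val_cnf [simp]: "cnf_val (cnf \<alpha>) = \<alpha>"
  unfolding cnf_def by (rule surj_f_inv_f) (metis cnf_val_surj surjI)

lemma cnf_cnf_val [simp]: "cnf (cnf_val M) = M"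
  by (rule cnf_val_eq_iff[THEN iffD1]) simp

lemma cnf_less_iff [simp]: "cnf \<alpha> < cnf \<beta> \<longleftrightarrow> \<alpha> < \<beta>"
  by (simp flip: cnf_val_less_iff)

lemma less_omega_pow_iff_cnf: "\<alpha> < omega_pow \<gamma> \<longleftrightarrow> (\<forall>\<beta>\<in>#cnf \<alpha>. \<beta> < \<gamma>)"
  using cnf_val_less_omega_pow_iff[of "cnf \<alpha>"] by simp

lemma cnf_val_replicate: "cnf_val (replicate_mset n \<beta>) = omega_pow \<beta> * ordinal_of_nat n"
proof (induction n)
  case (Suc n)
  have "cnf_val (replicate_mset n \<beta> + {#\<beta>#}) = cnf_val (replicate_mset n \<beta>) + cnf_val {#\<beta>#}"
    by (rule cnf_val_add) (simp split: if_splits)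
  with Suc show ?case by (simp add: times_distrib_ordinal)
qed simp

lemma ordinal_of_nat_eq_cnf_val: "ordinal_of_nat n = cnf_val (replicate_mset n 0)"
  by (simp add: cnf_val_replicate)

section \<open>Natural sum and natural product\<close>

text \<open>The Hessenberg sum. Unlike \<open>+\<close> it is strictly monotone in both arguments,
  as the rank of a union requires.\<close>

definition nat_add :: "'a ordinal \<Rightarrow> 'a ordinal \<Rightarrow> 'a ordinal" where
  "nat_add \<alpha> \<beta> = cnf_val (cnf \<alpha> + cnf \<beta>)"

lemma nat_add_strict_mono:
  "\<alpha> < \<alpha>' \<Longrightarrow> nat_add \<alpha> \<beta> < nat_add \<alpha>' \<beta>"
  "\<beta> < \<beta>' \<Longrightarrow> nat_add \<alpha> \<beta> < nat_add \<alpha> \<beta>'"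
  by (simp_all add: nat_add_def)

lemma nat_add_less_omega_pow:
  "\<alpha> < omega_pow \<gamma> \<Longrightarrow> \<beta> < omega_pow \<gamma> \<Longrightarrow> nat_add \<alpha> \<beta> < omega_pow \<gamma>"
  by (auto simp: nat_add_def cnf_val_less_omega_pow_iff less_omega_pow_iff_cnf[of \<alpha>]
      less_omega_pow_iff_cnf[of \<beta>])

text \<open>The exponents of the Hessenberg product of \<open>cnf_val M\<close> and
  \<open>cnf_val N\<close>.\<close>

definition exponent_products :: "'a ordinal multiset \<Rightarrow> 'a ordinal multiset \<Rightarrow> 'a ordinal multiset" where
  "exponent_products M N = (\<Sum>p\<in>#M. image_mset (nat_add p) N)"

lemma exponent_products_simps [simp]:
  "exponent_products {#} N = {#}"
  "exponent_products M {#} = {#}"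
  "exponent_products {#p#} {#q#} = {#nat_add p q#}"
  "exponent_products (M + M') N = exponent_products M N + exponent_products M' N"
  "exponent_products M (N + N') = exponent_products M N + exponent_products M N'"
  by (simp_all add: exponent_products_def sum_mset.distrib)

lemma in_exponent_products_iff:
  "x \<in># exponent_products M N \<longleftrightarrow> (\<exists>p\<in>#M. \<exists>q\<in>#N. x = nat_add p q)"
  by (auto simp: exponent_products_def)

lemma omega_pow_one: "omega_pow 1 = omega"
  by (rule ord_eqI) (auto simp: less_omega_pow_iff[of _ 1] less_omega_iff intro: exI[of _ 0])

section \<open>The shift of exponents and left subtraction of 1\<close>

lemma prime_exponent_ge: "\<beta> \<le> prime_exponent \<beta>"
  by (simp add: prime_exponent_def)

lemma prime_exponent_eqI:
  assumes "epsilon_number \<epsilon>" "n < omega" "\<beta> = \<epsilon> + n"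
  shows "prime_exponent \<beta> = \<beta> + 1"
proof -
  have "\<exists>\<epsilon> n. epsilon_number \<epsilon> \<and> n < omega \<and> \<beta> = \<epsilon> + n"
    using assms by blast
  then show ?thesis unfolding prime_exponent_def by (rule if_P)
qed

text \<open>Strictness is in danger only if \<open>\<beta>\<close> is shifted and
  \<open>\<gamma> = \<beta> + 1\<close>. But if \<open>\<beta>\<close> is an epsilon-number plus a
  finite ordinal then so is \<open>\<gamma>\<close>, which is therefore shifted too.\<close>

lemma prime_exponent_strict_mono:
  assumes "\<beta> < \<gamma>"
  shows "prime_exponent \<beta> < prime_exponent \<gamma>"
proof (cases "\<beta> + 1 < \<gamma>")
  case True
  have "prime_exponent \<beta> \<le> \<beta> + 1" by (simp add: prime_exponent_def)
  with True prime_exponent_ge[of \<gamma>] show ?thesis by simp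
next
  case False
  with assms have \<gamma>: "\<gamma> = \<beta> + 1"
    by (metis add_one_le_iff order.antisym not_less)
  show ?thesis
  proof (cases "\<exists>\<epsilon> n. epsilon_number \<epsilon> \<and> n < omega \<and> \<beta> = \<epsilon> + n")
    case True
    then obtain \<epsilon> k where "epsilon_number \<epsilon>" "\<beta> = \<epsilon> + ordinal_of_nat k"
      by (auto simp: less_omega_iff)
    then have "epsilon_number \<epsilon>" "ordinal_of_nat (Suc k) < (omega :: 'a ordinal)" "\<gamma> = \<epsilon> + ordinal_of_nat (Suc k)"
      by (auto simp: \<gamma> add.assoc less_omega_iff simp del: ordinal_of_nat.simps(2)) simp
    then have "prime_exponent \<gamma> = \<gamma> + 1" by (rule prime_exponent_eqI)
    moreover have "prime_exponent \<beta> \<le> \<beta> + 1" by (simp add: prime_exponent_def)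
    ultimately show ?thesis by (simp add: \<gamma>)
  next
    case False
    then have "prime_exponent \<beta> = \<beta>" unfolding prime_exponent_def by (rule if_not_P)
    with assms prime_exponent_ge[of \<gamma>] show ?thesis by simp
  qed
qed

lemma prime_exponent_mono: "\<beta> \<le> \<gamma> \<Longrightarrow> prime_exponent \<beta> \<le> prime_exponent \<gamma>"
  using prime_exponent_strict_mono by (metis le_less)

lemma not_epsilon_number_0: "\<not> epsilon_number 0"
  unfolding epsilon_number_def by (metis omega_pow_neq_0)

lemma prime_exponent_0 [simp]: "prime_exponent 0 = 0"
  unfolding prime_exponent_def using not_epsilon_number_0 by (metis add_eq_0_iff_ordinal)

text \<open>\<open>\<beta> < omega_pow \<beta>\<close> can fail only at an epsilon-number, and there
  the shift restores strictness.\<close>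

lemma less_omega_pow_prime_exponent: "\<beta> < omega_pow (prime_exponent \<beta>)"
proof (cases "omega_pow \<beta> = \<beta>")
  case True
  then have "prime_exponent \<beta> = \<beta> + 1"
    by (intro prime_exponent_eqI[of \<beta> 0]) (auto simp: epsilon_number_def less_omega_iff intro: exI[of _ 0])
  then have "omega_pow \<beta> < omega_pow (prime_exponent \<beta>)" by simp
  with True show ?thesis by simp
next
  case False
  with le_omega_pow[of \<beta>] have "\<beta> < omega_pow \<beta>" by simp
  also have "\<dots> \<le> omega_pow (prime_exponent \<beta>)" using prime_exponent_ge by simp
  finally show ?thesis .
qed

lemma cnf_exponents_cnf_val: "cnf_exponents (cnf_val M) = rev (sorted_list_of_multiset M)"
  unfolding cnf_exponents_def
proof (rule the_equality)
  fix \<alpha>s assume \<alpha>s: "sorted_wrt (\<ge>) \<alpha>s \<and> cnf_val M = omega_sum \<alpha>s"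
  then have "M = mset \<alpha>s"
    using cnf_val_mset(2)[of \<alpha>s] by (simp flip: cnf_val_eq_iff)
  with \<alpha>s cnf_val_mset(1) show "\<alpha>s = rev (sorted_list_of_multiset M)" by metis
qed (simp add: cnf_val_def sorted_wrt_rev)

lemma ordinal_hat_cnf_val: "ordinal_hat (cnf_val M) = cnf_val (image_mset prime_exponent M)"
proof -
  let ?l = "rev (sorted_list_of_multiset M)"
  have "sorted_wrt (\<lambda>x y. prime_exponent y \<le> prime_exponent x) ?l"
    by (rule sorted_wrt_mono_rel[of _ "(\<ge>)"]) (simp_all add: sorted_wrt_rev prime_exponent_mono)
  then have "cnf_val (mset (map prime_exponent ?l)) = omega_sum (map prime_exponent ?l)"
    by (intro cnf_val_mset) (simp add: sorted_wrt_map)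
  then show ?thesis
    by (simp add: ordinal_hat_def cnf_exponents_cnf_val)
qed

lemma minus_one_eqI: "1 + \<gamma> = \<alpha> \<Longrightarrow> minus_one \<alpha> = \<gamma>"
  unfolding minus_one_def by (rule the_equality) auto

lemma one_plus_infinite:
  fixes \<alpha> :: "'a ordinal"
  assumes "\<not> \<alpha> < omega"
  shows "1 + \<alpha> = \<alpha>"
proof -
  obtain \<delta> where \<alpha>: "\<alpha> = omega + \<delta>"
    using assms le_imp_add_ordinal not_less by metis
  have "1 + (omega :: 'a ordinal) = omega"
    using add_omega_pow_absorb[of 1 1] omega_pow_strict_mono[of 0 1] by (simp add: omega_pow_one)
  then show ?thesis
    unfolding \<alpha> by (simp flip: add.assoc)
qed

section \<open>Upper and lower bounds for ranks\<close>

abbreviation (input) residual :: "('b \<Rightarrow> 'b \<Rightarrow> bool) \<Rightarrow> 'b set \<Rightarrow> 'b \<Rightarrow> 'b set" where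
  "residual P Y y \<equiv> {z \<in> Y. P y z}"

text \<open>\<open>P y z\<close> says that \<open>z\<close> may come after \<open>y\<close>:
  \<open>bad le\<close> gives bad sequences, \<open>incomparable le\<close> gives antichains. After
  a choice only the residual set matters, so the sequences themselves disappear, and trees over
  different types can be compared. An upper bound also entails that the tree is
  well-founded.\<close>

inductive rank_le :: "('b \<Rightarrow> 'b \<Rightarrow> bool) \<Rightarrow> 'b set \<Rightarrow> 'a ordinal \<Rightarrow> bool" for P where
  "(\<And>y. y \<in> Y \<Longrightarrow> \<exists>\<beta><\<alpha>. rank_le P (residual P Y y) \<beta>) \<Longrightarrow> rank_le P Y \<alpha>"

inductive rank_ge :: "('b \<Rightarrow> 'b \<Rightarrow> bool) \<Rightarrow> 'b set \<Rightarrow> 'a ordinal \<Rightarrow> bool" for P where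
  "(\<And>\<beta>. \<beta> < \<alpha> \<Longrightarrow> \<exists>y\<in>Y. rank_ge P (residual P Y y) \<beta>) \<Longrightarrow> rank_ge P Y \<alpha>"

lemma rank_leI: "(\<And>y. y \<in> Y \<Longrightarrow> \<exists>\<beta><\<alpha>. rank_le P (residual P Y y) \<beta>) \<Longrightarrow> rank_le P Y \<alpha>"
  by (rule rank_le.intros)

lemma rank_leD: "rank_le P Y \<alpha> \<Longrightarrow> y \<in> Y \<Longrightarrow> \<exists>\<beta><\<alpha>. rank_le P (residual P Y y) \<beta>"
  by (erule rank_le.cases) blast

lemma rank_geI: "(\<And>\<beta>. \<beta> < \<alpha> \<Longrightarrow> \<exists>y\<in>Y. rank_ge P (residual P Y y) \<beta>) \<Longrightarrow> rank_ge P Y \<alpha>"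
  by (rule rank_ge.intros)

lemma rank_geD: "rank_ge P Y \<alpha> \<Longrightarrow> \<beta> < \<alpha> \<Longrightarrow> \<exists>y\<in>Y. rank_ge P (residual P Y y) \<beta>"
  by (erule rank_ge.cases) blast

text \<open>\<open>f\<close> carries admissible sequences in \<open>Y\<close> to admissible
  sequences in \<open>Z\<close> of the same length, so bounds for \<open>Z\<close> pass back to
  \<open>Y\<close>. \<open>rank_ge_map\<close> is the same transfer for lower bounds, in the
  opposite direction.\<close>

lemma rank_le_map:
  assumes "rank_le Q Z \<alpha>" "f ` Y \<subseteq> Z"
    and "\<And>y y'. y \<in> Y \<Longrightarrow> y' \<in> Y \<Longrightarrow> P y y' \<Longrightarrow> Q (f y) (f y')"
  shows "rank_le P Y \<alpha>"
  using assms
proof (induction \<alpha> arbitrary: Y Z rule: less_induct)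
  case (less \<alpha>)
  show ?case
  proof (rule rank_leI)
    fix y assume y: "y \<in> Y"
    then obtain \<beta> where \<beta>: "\<beta> < \<alpha>" "rank_le Q (residual Q Z (f y)) \<beta>"
      using rank_leD[OF less.prems(1)] less.prems(2) by blast
    have "rank_le P (residual P Y y) \<beta>"
      by (rule less.IH[OF \<beta>]) (use less.prems y in auto)
    with \<beta>(1) show "\<exists>\<beta><\<alpha>. rank_le P (residual P Y y) \<beta>" by blast
  qed
qed

lemma rank_ge_map:
  assumes "rank_ge Q Z \<alpha>" "f ` Z \<subseteq> Y"
    and "\<And>z z'. z \<in> Z \<Longrightarrow> z' \<in> Z \<Longrightarrow> Q z z' \<Longrightarrow> P (f z) (f z')"
  shows "rank_ge P Y \<alpha>"
  using assms
proof (induction \<alpha> arbitrary: Y Z rule: less_induct)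
  case (less \<alpha>)
  show ?case
  proof (rule rank_geI)
    fix \<beta> assume \<beta>: "\<beta> < \<alpha>"
    then obtain z where z: "z \<in> Z" "rank_ge Q (residual Q Z z) \<beta>"
      using rank_geD[OF less.prems(1)] by blast
    have "rank_ge P (residual P Y (f z)) \<beta>"
      by (rule less.IH[OF \<beta> z(2)]) (use less.prems z in auto)
    with z(1) less.prems(2) show "\<exists>y\<in>Y. rank_ge P (residual P Y y) \<beta>" by blast
  qed
qed

lemma rank_le_subset: "rank_le P Z \<alpha> \<Longrightarrow> Y \<subseteq> Z \<Longrightarrow> rank_le P Y \<alpha>"
  by (rule rank_le_map[where Q = P and Z = Z and f = id]) auto

lemma rank_ge_superset: "rank_ge P Z \<alpha> \<Longrightarrow> Z \<subseteq> Y \<Longrightarrow> rank_ge P Y \<alpha>"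
  by (rule rank_ge_map[where Q = P and Z = Z and f = id]) auto

lemma rank_le_mono: "rank_le P Y \<alpha> \<Longrightarrow> \<alpha> \<le> \<beta> \<Longrightarrow> rank_le P Y \<beta>"
  by (rule rank_leI) (drule (1) rank_leD, auto intro: less_le_trans)

lemma rank_ge_mono: "rank_ge P Y \<alpha> \<Longrightarrow> \<beta> \<le> \<alpha> \<Longrightarrow> rank_ge P Y \<beta>"
  by (rule rank_geI) (erule rank_geD, erule less_le_trans)

lemma rank_le_empty [simp]: "rank_le P {} \<alpha>"
  by (rule rank_leI) simp

lemma rank_ge_0 [simp]: "rank_ge P Y 0"
  by (rule rank_geI) simp

lemma rank_le_0_iff [simp]: "rank_le P Y 0 \<longleftrightarrow> Y = {}"
  using rank_leD[of P Y 0] by auto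

lemma rank_ge_1: "Y \<noteq> {} \<Longrightarrow> rank_ge P Y 1"
  by (rule rank_geI) auto

lemma rank_ge_nonempty: "rank_ge P Y \<alpha> \<Longrightarrow> \<alpha> \<noteq> 0 \<Longrightarrow> Y \<noteq> {}"
  using rank_geD[of P Y \<alpha> 0] zero_less_ordinal_iff by blast

lemma rank_ge_le:
  assumes "rank_ge P Y \<alpha>" "rank_le P Y \<beta>"
  shows "\<alpha> \<le> \<beta>"
  using assms
proof (induction \<beta> arbitrary: \<alpha> Y rule: less_induct)
  case (less \<beta>)
  show ?case
  proof (rule ccontr)
    assume "\<not> \<alpha> \<le> \<beta>"
    then have "\<beta> < \<alpha>" by simp
    then obtain y where y: "y \<in> Y" "rank_ge P (residual P Y y) \<beta>"
      using rank_geD[OF less.prems(1)] by blast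
    obtain \<beta>' where "\<beta>' < \<beta>" "rank_le P (residual P Y y) \<beta>'"
      using rank_leD[OF less.prems(2) y(1)] by blast
    with less.IH y(2) show False by (meson leD)
  qed
qed

text \<open>The least upper bound is also a lower bound. The induction supplies exact ranks of
  residuals, which turn the failure of smaller upper bounds into a lower bound.\<close>

lemma rank_exact:
  fixes \<rho> :: "'a ordinal"
  assumes "rank_le P Y \<rho>"
  obtains \<beta> where "\<beta> \<le> \<rho>" "rank_le P Y \<beta>" "rank_ge P Y \<beta>"
  using assms
proof (induction \<rho> arbitrary: Y thesis rule: less_induct)
  case (less \<rho>)
  define \<beta> :: "'a ordinal" where "\<beta> = (LEAST b. rank_le P Y b)"
  have le: "rank_le P Y \<beta>"
    unfolding \<beta>_def using less.prems(2) by (rule LeastI)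
  have \<beta>\<rho>: "\<beta> \<le> \<rho>"
    unfolding \<beta>_def using less.prems(2) by (rule Least_le)
  have "rank_ge P Y \<beta>"
  proof (rule rank_geI)
    fix \<gamma> assume \<gamma>: "\<gamma> < \<beta>"
    then have "\<not> rank_le P Y \<gamma>"
      unfolding \<beta>_def by (rule not_less_Least)
    then obtain y where y: "y \<in> Y" "\<And>\<delta>. \<delta> < \<gamma> \<Longrightarrow> \<not> rank_le P (residual P Y y) \<delta>"
      using rank_leI[where P = P and Y = Y and \<alpha> = \<gamma>] by blast
    obtain \<beta>' where \<beta>': "\<beta>' < \<beta>" "rank_le P (residual P Y y) \<beta>'"
      using rank_leD[OF le y(1)] by blast
    then have "\<beta>' < \<rho>" using \<beta>\<rho> by simp
    then obtain \<delta> :: "'a ordinal"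
      where \<delta>: "rank_le P (residual P Y y) \<delta>" "rank_ge P (residual P Y y) \<delta>"
      using less.IH[OF _ _ \<beta>'(2)] by blast
    then have "\<gamma> \<le> \<delta>" using y(2) not_less by blast
    with \<delta>(2) y(1) rank_ge_mono show "\<exists>y\<in>Y. rank_ge P (residual P Y y) \<gamma>" by blast
  qed
  with le \<beta>\<rho> less.prems(1) show thesis by blast
qed

section \<open>Cutting a well partial order, and ranks of unions\<close>

abbreviation (input) bad :: "('b \<Rightarrow> 'b \<Rightarrow> bool) \<Rightarrow> 'b \<Rightarrow> 'b \<Rightarrow> bool" where
  "bad le \<equiv> \<lambda>x y. \<not> le x y"

text \<open>\<open>A\<close> is what a suitable bad sequence leaves over. An element outside
  \<open>A\<close> is above some term of that sequence; if it were below some \<open>a\<close>,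
  transitivity would have removed \<open>a\<close> as well.\<close>

lemma rank_node:
  fixes \<rho> \<zeta> :: "'a ordinal"
  assumes "transp le" "rank_le (bad le) Y \<rho>" "rank_ge (bad le) Y \<zeta>"
  obtains A where "A \<subseteq> Y" "rank_le (bad le) A \<zeta>" "rank_ge (bad le) A \<zeta>"
    "\<forall>a\<in>A. \<forall>u\<in>Y - A. \<not> le u a"
  using assms(2,3)
proof (induction \<rho> arbitrary: Y thesis rule: less_induct)
  case (less \<rho>)
  obtain \<beta> where \<beta>: "\<beta> \<le> \<rho>" "rank_le (bad le) Y \<beta>" "rank_ge (bad le) Y \<beta>"
    using rank_exact[OF less.prems(2)] by blast
  have "\<zeta> \<le> \<beta>"
    using rank_ge_le[OF less.prems(3) \<beta>(2)] .
  show thesis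
  proof (cases "\<zeta> = \<beta>")
    case True
    show thesis by (rule less.prems(1)[of Y]) (use True \<beta> in auto)
  next
    case False
    with \<open>\<zeta> \<le> \<beta>\<close> have "\<zeta> < \<beta>" by simp
    then obtain y where y: "y \<in> Y" "rank_ge (bad le) (residual (bad le) Y y) \<zeta>"
      using rank_geD[OF \<beta>(3)] by blast
    obtain \<beta>' where \<beta>': "\<beta>' < \<beta>" "rank_le (bad le) (residual (bad le) Y y) \<beta>'"
      using rank_leD[OF \<beta>(2) y(1)] by blast
    have "\<beta>' < \<rho>" using \<beta>'(1) \<beta>(1) by simp
    then obtain A where A: "A \<subseteq> residual (bad le) Y y" "rank_le (bad le) A \<zeta>" "rank_ge (bad le) A \<zeta>"
      "\<forall>a\<in>A. \<forall>u\<in>residual (bad le) Y y - A. \<not> le u a"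
      using less.IH[OF _ _ \<beta>'(2) y(2)] by blast
    have "\<forall>a\<in>A. \<forall>u\<in>Y - A. \<not> le u a"
    proof (intro ballI)
      fix a u assume a: "a \<in> A" and u: "u \<in> Y - A"
      show "\<not> le u a"
      proof (cases "le y u")
        case True
        then show ?thesis using a A(1) assms(1) by (auto dest: transpD)
      qed (use A(4) a u in auto)
    qed
    with A less.prems(1)[of A] show thesis by auto
  qed
qed

text \<open>Every sequence through \<open>U\<close> can be continued by one through
  \<open>A\<close>. The part that is used first contributes the right summand.\<close>

lemma rank_ge_add:
  assumes "\<And>a u. a \<in> A \<Longrightarrow> u \<in> U \<Longrightarrow> P u a" "rank_ge P A \<zeta>" "rank_ge P U \<eta>"
  shows "rank_ge P (A \<union> U) (\<zeta> + \<eta>)"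
  using assms(1,3)
proof (induction \<eta> arbitrary: U rule: less_induct)
  case (less \<eta>)
  show ?case
  proof (rule rank_geI)
    fix \<gamma> assume "\<gamma> < \<zeta> + \<eta>"
    then consider "\<gamma> < \<zeta>" | \<delta> where "\<delta> < \<eta>" "\<gamma> \<le> \<zeta> + \<delta>"
      unfolding less_add_ordinal_iff by blast
    then show "\<exists>y\<in>A \<union> U. rank_ge P (residual P (A \<union> U) y) \<gamma>"
    proof cases
      case 1
      then obtain y where y: "y \<in> A" "rank_ge P (residual P A y) \<gamma>"
        using rank_geD[OF assms(2)] by blast
      have "rank_ge P (residual P (A \<union> U) y) \<gamma>"
        by (rule rank_ge_superset[OF y(2)]) auto
      with y(1) show ?thesis by blast
    next
      case 2
      then obtain u where u: "u \<in> U" "rank_ge P (residual P U u) \<delta>"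
        using rank_geD[OF less.prems(2)] by blast
      have "rank_ge P (A \<union> residual P U u) (\<zeta> + \<delta>)"
        by (rule less.IH[OF 2(1)]) (use less.prems u in auto)
      then have "rank_ge P (residual P (A \<union> U) u) (\<zeta> + \<delta>)"
        by (rule rank_ge_superset) (use less.prems u in auto)
      then show ?thesis using u 2(2) rank_ge_mono by blast
    qed
  qed
qed

text \<open>\<open>A\<close> is cut off at rank exactly \<open>\<zeta>\<close>. If the complement
  has exact rank \<open>\<upsilon>\<close>, then \<open>\<zeta> + \<upsilon>\<close> is a lower
  bound for \<open>X\<close>, hence at most \<open>\<zeta> + \<eta>\<close>, and left cancellation
  applies.\<close>

lemma rank_le_split:
  fixes \<zeta> \<eta> :: "'a ordinal"
  assumes "transp le" "rank_le (bad le) X (\<zeta> + \<eta>)"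
  obtains A where "A \<subseteq> X" "rank_le (bad le) A \<zeta>" "rank_le (bad le) (X - A) \<eta>"
proof (cases "rank_le (bad le) X \<zeta>")
  case True
  show ?thesis by (rule that[of X]) (use True in auto)
next
  case False
  obtain \<beta> :: "'a ordinal" where \<beta>: "rank_le (bad le) X \<beta>" "rank_ge (bad le) X \<beta>"
    using rank_exact[OF assms(2)] by blast
  have "\<not> \<beta> \<le> \<zeta>" using rank_le_mono[OF \<beta>(1)] False by blast
  then have "rank_ge (bad le) X \<zeta>" using rank_ge_mono[OF \<beta>(2)] by simp
  then obtain A where A: "A \<subseteq> X" "rank_le (bad le) A \<zeta>" "rank_ge (bad le) A \<zeta>"
    "\<forall>a\<in>A. \<forall>u\<in>X - A. \<not> le u a"
    using rank_node[OF assms] by blast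
  have "rank_le (bad le) (X - A) (\<zeta> + \<eta>)"
    by (rule rank_le_subset[OF assms(2)]) auto
  then obtain \<upsilon> :: "'a ordinal" where \<upsilon>: "rank_le (bad le) (X - A) \<upsilon>" "rank_ge (bad le) (X - A) \<upsilon>"
    using rank_exact by blast
  have "rank_ge (bad le) (A \<union> (X - A)) (\<zeta> + \<upsilon>)"
    by (rule rank_ge_add) (use A \<upsilon> in auto)
  moreover have "A \<union> (X - A) = X" using A by auto
  ultimately have "\<zeta> + \<upsilon> \<le> \<zeta> + \<eta>"
    using rank_ge_le assms(2) by metis
  with \<upsilon>(1) have "rank_le (bad le) (X - A) \<eta>"
    by (auto elim: rank_le_mono)
  with A that show ?thesis by blast
qed

text \<open>Each choice lowers the rank of one part and does not raise that of the other.\<close>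

lemma rank_le_Un:
  assumes "rank_le P A \<alpha>" "rank_le P B \<beta>"
  shows "rank_le P (A \<union> B) (nat_add \<alpha> \<beta>)"
  using assms
proof (induction \<alpha> arbitrary: A B \<beta> rule: less_induct)
  case (less \<alpha>)
  note IH\<alpha> = less.IH
  show ?case
    using less.prems
  proof (induction \<beta> arbitrary: A B rule: less_induct)
    case (less \<beta>)
    show ?case
    proof (rule rank_leI)
      fix y assume y: "y \<in> A \<union> B"
      have eq: "residual P (A \<union> B) y = residual P A y \<union> residual P B y" by auto
      have sub: "rank_le P (residual P A y) \<alpha>" "rank_le P (residual P B y) \<beta>"
        using less.prems by (auto elim: rank_le_subset)
      from y show "\<exists>\<gamma><nat_add \<alpha> \<beta>. rank_le P (residual P (A \<union> B) y) \<gamma>"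
      proof
        assume "y \<in> A"
        then obtain \<alpha>' where "\<alpha>' < \<alpha>" "rank_le P (residual P A y) \<alpha>'"
          using rank_leD[OF less.prems(1)] by blast
        with sub(2) show ?thesis
          unfolding eq using IH\<alpha> nat_add_strict_mono(1) by blast
      next
        assume "y \<in> B"
        then obtain \<beta>' where "\<beta>' < \<beta>" "rank_le P (residual P B y) \<beta>'"
          using rank_leD[OF less.prems(2)] by blast
        with sub(1) show ?thesis
          unfolding eq using less.IH nat_add_strict_mono(2) by blast
      qed
    qed
  qed
qed

lemma rank_le_UN:
  assumes "finite I" "\<And>i. i \<in> I \<Longrightarrow> \<exists>\<beta>. \<beta> < omega_pow \<gamma> \<and> rank_le P (S i) \<beta>"
  shows "\<exists>\<beta>. \<beta> < omega_pow \<gamma> \<and> rank_le P (\<Union>i\<in>I. S i) \<beta>"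
  using assms
proof (induction I rule: finite_induct)
  case empty
  show ?case by (rule exI[of _ 0]) simp
next
  case (insert i I)
  then obtain \<beta> \<beta>' where "\<beta> < omega_pow \<gamma>" "rank_le P (S i) \<beta>"
    "\<beta>' < omega_pow \<gamma>" "rank_le P (\<Union>i\<in>I. S i) \<beta>'"
    by (metis insertCI)
  then have "nat_add \<beta> \<beta>' < omega_pow \<gamma>" "rank_le P (\<Union>i\<in>insert i I. S i) (nat_add \<beta> \<beta>')"
    by (simp_all add: nat_add_less_omega_pow rank_le_Un)
  then show ?case by blast
qed

text \<open>Counterpart of \<open>rank_le_split\<close> for lower bounds: a complement of rank below
  \<open>\<eta>\<close> would, by \<open>rank_le_Un\<close>, make the rank of \<open>X\<close>
  smaller than \<open>\<alpha>\<close>.\<close>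

lemma rank_ge_split:
  fixes \<rho> \<alpha> \<zeta> \<eta> :: "'a ordinal"
  assumes "transp le" "rank_le (bad le) X \<rho>" "rank_ge (bad le) X \<alpha>" "\<zeta> \<le> \<alpha>"
    and "\<And>\<upsilon>. \<upsilon> < \<eta> \<Longrightarrow> nat_add \<zeta> \<upsilon> < \<alpha>"
  obtains A where "A \<subseteq> X" "rank_le (bad le) A \<zeta>" "rank_ge (bad le) A \<zeta>" "rank_ge (bad le) (X - A) \<eta>"
    "\<forall>a\<in>A. \<forall>u\<in>X - A. \<not> le u a"
proof -
  have "rank_ge (bad le) X \<zeta>"
    using assms(3,4) by (rule rank_ge_mono)
  then obtain A where A: "A \<subseteq> X" "rank_le (bad le) A \<zeta>" "rank_ge (bad le) A \<zeta>"
    "\<forall>a\<in>A. \<forall>u\<in>X - A. \<not> le u a"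
    using rank_node[OF assms(1,2)] by blast
  have "rank_le (bad le) (X - A) \<rho>"
    by (rule rank_le_subset[OF assms(2)]) auto
  then obtain \<upsilon> :: "'a ordinal" where \<upsilon>: "rank_le (bad le) (X - A) \<upsilon>" "rank_ge (bad le) (X - A) \<upsilon>"
    using rank_exact by blast
  have "rank_le (bad le) (A \<union> (X - A)) (nat_add \<zeta> \<upsilon>)"
    using A(2) \<upsilon>(1) by (rule rank_le_Un)
  moreover have "A \<union> (X - A) = X" using A by auto
  ultimately have "\<alpha> \<le> nat_add \<zeta> \<upsilon>"
    using rank_ge_le assms(3) by metis
  then have "\<not> \<upsilon> < \<eta>" using assms(5) by (meson leD)
  then have "rank_ge (bad le) (X - A) \<eta>"
    using \<upsilon>(2) by (auto elim: rank_ge_mono)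
  with A that show ?thesis by blast
qed

section \<open>Products\<close>

lemma split_min_mset:
  fixes M :: "'b :: linorder multiset"
  assumes "M \<noteq> {#}"
  obtains Z c where "M = Z + {#c#}" "\<And>z. z \<in># Z \<Longrightarrow> c \<le> z"
proof (rule that)
  have "Min_mset M \<in># M" using assms by simp
  then show "M = (M - {#Min_mset M#}) + {#Min_mset M#}" by simp
  show "Min_mset M \<le> z" if "z \<in># M - {#Min_mset M#}" for z
    using in_diffD[OF that] by simp
qed

text \<open>The bound for a product order by the natural product, with \<open>f\<close> and
  \<open>g\<close> as coordinates. After a choice two products remain, each with one factor
  decreased; in general they do not add up to less than the whole (for 2 and 2 one gets 1*2 + 2*1 =
  4). Both factors are therefore first split into indecomposable pieces. For single exponents
  \<open>c\<close> and \<open>d\<close> all exponents of the two products are below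
  \<open>nat_add c d\<close>, and so is their natural sum below that power.\<close>

lemma rank_le_product:
  assumes "transp leA" "transp leB"
    and "rank_le (bad leA) A (cnf_val M)" "rank_le (bad leB) B (cnf_val N)" "f ` Y \<subseteq> A" "g ` Y \<subseteq> B"
    and "\<And>y y'. y \<in> Y \<Longrightarrow> y' \<in> Y \<Longrightarrow> P y y' \<Longrightarrow> \<not> leA (f y) (f y') \<or> \<not> leB (g y) (g y')"
  shows "rank_le P Y (cnf_val (exponent_products M N))"
  using assms(3-)
proof (induction M arbitrary: A B N Y rule: less_induct)
  case (less M)
  note IHM = less.IH
  show ?case
    using less.prems
  proof (induction N arbitrary: A B Y rule: less_induct)
    case (less N)
    note prems = less.prems and IHN = less.IH
    note P = prems(5)
    show ?case
    proof (cases "M = {#} \<or> N = {#}")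
      case True
      then have "Y = {}" using prems by auto
      then show ?thesis by simp
    next
      case False
      obtain Z c where M: "M = Z + {#c#}" "\<And>z. z \<in># Z \<Longrightarrow> c \<le> z"
        using False split_min_mset by blast
      obtain Z' d where N: "N = Z' + {#d#}" "\<And>z. z \<in># Z' \<Longrightarrow> d \<le> z"
        using False split_min_mset by blast
      show ?thesis
      proof (cases "Z = {#}")
        case Z: False
        have "cnf_val M = cnf_val Z + cnf_val {#c#}"
          unfolding M(1) by (rule cnf_val_add) (use M(2) in auto)
        then obtain A' where A': "rank_le (bad leA) A' (cnf_val Z)"
          "rank_le (bad leA) (A - A') (cnf_val {#c#})"
          using rank_le_split[OF assms(1)] prems(1) by metis
        have "rank_le P {y \<in> Y. f y \<in> A'} (cnf_val (exponent_products Z N))"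
          by (rule IHM[OF _ A'(1) prems(2)]) (use prems P in \<open>auto simp: M(1)\<close>)
        moreover have "rank_le P {y \<in> Y. f y \<notin> A'} (cnf_val (exponent_products {#c#} N))"
          by (rule IHM[OF _ A'(2) prems(2)]) (use prems P Z in \<open>auto simp: M(1)\<close>)
        ultimately have "rank_le P ({y \<in> Y. f y \<in> A'} \<union> {y \<in> Y. f y \<notin> A'})
            (nat_add (cnf_val (exponent_products Z N)) (cnf_val (exponent_products {#c#} N)))"
          by (rule rank_le_Un)
        moreover have "{y \<in> Y. f y \<in> A'} \<union> {y \<in> Y. f y \<notin> A'} = Y" by auto
        ultimately show ?thesis by (simp only: M(1) nat_add_def exponent_products_simps cnf_cnf_val)
      next
        case True
        with M have M: "M = {#c#}" by simp
        show ?thesis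
        proof (cases "Z' = {#}")
          case Z': False
          have "cnf_val N = cnf_val Z' + cnf_val {#d#}"
            unfolding N(1) by (rule cnf_val_add) (use N(2) in auto)
          then obtain B' where B': "rank_le (bad leB) B' (cnf_val Z')"
            "rank_le (bad leB) (B - B') (cnf_val {#d#})"
            using rank_le_split[OF assms(2)] prems(2) by metis
          have "rank_le P {y \<in> Y. g y \<in> B'} (cnf_val (exponent_products M Z'))"
            by (rule IHN[OF _ prems(1) B'(1)]) (use prems P in \<open>auto simp: N(1)\<close>)
          moreover have "rank_le P {y \<in> Y. g y \<notin> B'} (cnf_val (exponent_products M {#d#}))"
            by (rule IHN[OF _ prems(1) B'(2)]) (use prems P Z' in \<open>auto simp: N(1)\<close>)
          ultimately have "rank_le P ({y \<in> Y. g y \<in> B'} \<union> {y \<in> Y. g y \<notin> B'})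
              (nat_add (cnf_val (exponent_products M Z')) (cnf_val (exponent_products M {#d#})))"
            by (rule rank_le_Un)
          moreover have "{y \<in> Y. g y \<in> B'} \<union> {y \<in> Y. g y \<notin> B'} = Y" by auto
          ultimately show ?thesis by (simp only: N(1) nat_add_def exponent_products_simps cnf_cnf_val)
        next
          case True
          with N have N: "N = {#d#}" by simp
          show ?thesis
          proof (rule rank_leI)
            fix y assume y: "y \<in> Y"
            obtain \<alpha>' where "\<alpha>' < cnf_val M" "rank_le (bad leA) (residual (bad leA) A (f y)) \<alpha>'"
              using rank_leD[OF prems(1)] prems(3) y by blast
            then obtain M' where M': "M' < M" "rank_le (bad leA) (residual (bad leA) A (f y)) (cnf_val M')"
              using cnf_val_surj by (metis cnf_val_less_iff)
            obtain \<beta>' where "\<beta>' < cnf_val N" "rank_le (bad leB) (residual (bad leB) B (g y)) \<beta>'"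
              using rank_leD[OF prems(2)] prems(4) y by blast
            then obtain N' where N': "N' < N" "rank_le (bad leB) (residual (bad leB) B (g y)) (cnf_val N')"
              using cnf_val_surj by (metis cnf_val_less_iff)
            let ?Y = "residual P Y y"
            have "rank_le P {z \<in> ?Y. \<not> leA (f y) (f z)} (cnf_val (exponent_products M' N))"
              by (rule IHM[OF M'(1) M'(2) prems(2)]) (use prems P in auto)
            moreover have "rank_le P {z \<in> ?Y. \<not> leB (g y) (g z)} (cnf_val (exponent_products M N'))"
              by (rule IHN[OF N'(1) prems(1) N'(2)]) (use prems P in auto)
            ultimately have "rank_le P ({z \<in> ?Y. \<not> leA (f y) (f z)} \<union> {z \<in> ?Y. \<not> leB (g y) (g z)})
                (nat_add (cnf_val (exponent_products M' N)) (cnf_val (exponent_products M N')))"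
              by (rule rank_le_Un)
            moreover have "{z \<in> ?Y. \<not> leA (f y) (f z)} \<union> {z \<in> ?Y. \<not> leB (g y) (g z)} = ?Y"
              using P[OF y] by auto
            moreover have "nat_add (cnf_val (exponent_products M' N)) (cnf_val (exponent_products M N'))
                < cnf_val (exponent_products M N)"
            proof -
              have "\<forall>\<beta>\<in>#M'. \<beta> < c" "\<forall>\<beta>\<in>#N'. \<beta> < d"
                using M'(1) N'(1) by (simp_all add: M N flip: cnf_val_less_omega_pow_iff)
              then have "\<forall>x\<in>#exponent_products M' N + exponent_products M N'. x < nat_add c d"
                by (auto simp: in_exponent_products_iff M N nat_add_strict_mono)
              then show ?thesis
                by (simp only: M N exponent_products_simps(3) cnf_val_single cnf_val_less_omega_pow_iff
                    nat_add_def[of "cnf_val _" "cnf_val _"] cnf_cnf_val)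
            qed
            ultimately show "\<exists>\<gamma><cnf_val (exponent_products M N). rank_le P ?Y \<gamma>" by metis
          qed
        qed
      qed
    qed
  qed
qed

text \<open>A copy of rank \<open>\<alpha>\<close> is placed at each step \<open>u\<close> of a sequence in \<open>U\<close>. It is chosen inside the
  block \<open>B u\<close> only when the finitely many earlier elements \<open>S\<close> are known.\<close>

lemma rank_ge_lex:
  assumes B: "\<And>u. u \<in> U \<Longrightarrow> B u \<subseteq> Y"
    and block: "\<And>u S. u \<in> U \<Longrightarrow> finite S \<Longrightarrow> (\<And>s. s \<in> S \<Longrightarrow> \<exists>u'\<in>U. s \<in> B u' \<and> Q u' u) \<Longrightarrow>
      \<exists>B'\<subseteq>B u. rank_ge P B' \<alpha> \<and> (\<forall>s\<in>S. \<forall>y\<in>B'. P s y)"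
    and "rank_ge Q U \<beta>"
  shows "rank_ge P Y (\<alpha> * \<beta>)"
proof -
  \<comment> \<open>\<open>S\<close> holds the finitely many elements chosen so far, and
    \<open>U'\<close> the steps still available; the step of every chosen element must admit all of
    \<open>U'\<close> after it.\<close>
  have main: "rank_ge P {y \<in> Y. \<forall>s\<in>S. P s y} (\<alpha> * \<beta>)"
    if "rank_ge Q U' \<beta>" "U' \<subseteq> U" "finite S" "\<And>s. s \<in> S \<Longrightarrow> \<exists>u'\<in>U. s \<in> B u' \<and> (\<forall>u\<in>U'. Q u' u)"
    for U' S
    using that
  proof (induction \<beta> arbitrary: U' S rule: less_induct)
    case (less \<beta>)
    note prems = less.prems and IH = less.IH
    let ?Y = "\<lambda>S. {y \<in> Y. \<forall>s\<in>S. P s y}"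
    show ?case
    proof (rule rank_geI)
      fix \<gamma> assume "\<gamma> < \<alpha> * \<beta>"
      then obtain \<delta> \<xi> where \<delta>: "\<delta> < \<beta>" "\<xi> < \<alpha>" "\<gamma> \<le> \<alpha> * \<delta> + \<xi>"
        unfolding less_times_ordinal_iff by blast
      obtain u where u: "u \<in> U'" "rank_ge Q (residual Q U' u) \<delta>"
        using rank_geD[OF prems(1) \<delta>(1)] by blast
      have "\<exists>B'\<subseteq>B u. rank_ge P B' \<alpha> \<and> (\<forall>s\<in>S. \<forall>y\<in>B'. P s y)"
        by (rule block) (use u prems in blast)+
      then obtain B' where B': "B' \<subseteq> B u" "rank_ge P B' \<alpha>" "\<And>s y. s \<in> S \<Longrightarrow> y \<in> B' \<Longrightarrow> P s y"
        by blast
      \<comment> \<open>\<open>R\<close> collects the choices made inside the current block. Below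
        \<open>\<alpha> * \<delta>\<close> the block is left, and the outer induction continues with
        \<open>S \<union> R\<close> as the set of earlier elements.\<close>
      have inner: "rank_ge P (?Y (S \<union> R)) (\<alpha> * \<delta> + \<zeta>)"
        if "finite R" "R \<subseteq> B'" "rank_ge P {y \<in> B'. \<forall>r\<in>R. P r y} \<zeta>" for R \<zeta>
        using that
      proof (induction \<zeta> arbitrary: R rule: less_induct)
        case (less \<zeta>)
        show ?case
        proof (rule rank_geI)
          fix \<gamma> assume "\<gamma> < \<alpha> * \<delta> + \<zeta>"
          then consider "\<gamma> < \<alpha> * \<delta>" | \<eta> where "\<eta> < \<zeta>" "\<gamma> \<le> \<alpha> * \<delta> + \<eta>"
            unfolding less_add_ordinal_iff by blast
          then show "\<exists>y\<in>?Y (S \<union> R). rank_ge P (residual P (?Y (S \<union> R)) y) \<gamma>"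
          proof cases
            case 1
            have "rank_ge P (?Y (S \<union> R)) (\<alpha> * \<delta>)"
            proof (rule IH[OF \<delta>(1) u(2)])
              show "residual Q U' u \<subseteq> U" "finite (S \<union> R)"
                using prems less.prems by auto
              fix s assume "s \<in> S \<union> R"
              then show "\<exists>u'\<in>U. s \<in> B u' \<and> (\<forall>v\<in>residual Q U' u. Q u' v)"
              proof
                assume "s \<in> S"
                then show ?thesis using prems(4) by blast
              next
                assume "s \<in> R"
                then show ?thesis using less.prems(2) B'(1) u(1) prems(2) by blast
              qed
            qed
            with 1 show ?thesis using rank_geD by blast
          next
            case 2
            obtain y where y: "y \<in> B'" "\<forall>r\<in>R. P r y"
              "rank_ge P (residual P {y \<in> B'. \<forall>r\<in>R. P r y} y) \<eta>"
              using rank_geD[OF less.prems(3) 2(1)] by blast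
            have "residual P {y \<in> B'. \<forall>r\<in>R. P r y} y = {z \<in> B'. \<forall>r\<in>insert y R. P r z}" by auto
            with y(3) have "rank_ge P (?Y (S \<union> insert y R)) (\<alpha> * \<delta> + \<eta>)"
              by (intro less.IH[OF 2(1)]) (use y less.prems in simp_all)
            moreover have "?Y (S \<union> insert y R) = residual P (?Y (S \<union> R)) y" by auto
            ultimately have "rank_ge P (residual P (?Y (S \<union> R)) y) \<gamma>"
              using 2(2) rank_ge_mono by metis
            moreover have "y \<in> ?Y (S \<union> R)"
              using y B' B u(1) prems(2) by blast
            ultimately show ?thesis by blast
          qed
        qed
      qed
      have "rank_ge P (?Y S) (\<alpha> * \<delta> + \<alpha>)"
        using inner[of "{}"] B'(2) by simp
      moreover have "\<gamma> < \<alpha> * \<delta> + \<alpha>"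
        using \<delta> by (meson add_strict_left_mono_ordinal le_less_trans)
      ultimately show "\<exists>y\<in>?Y S. rank_ge P (residual P (?Y S) y) \<gamma>"
        using rank_geD by blast
    qed
  qed
  show ?thesis
    using main[OF assms(3), of "{}"] by simp
qed

section \<open>The multiset embedding\<close>

text \<open>The injection is replaced by its image \<open>k\<close>, a form that suits induction on
  multisets and the relator lemmas. \<open>mset_embeds_iff_emb\<close> links it to the injections
  between copies.\<close>

definition emb :: "('b \<Rightarrow> 'b \<Rightarrow> bool) \<Rightarrow> 'b multiset \<Rightarrow> 'b multiset \<Rightarrow> bool" where
  "emb le m m' \<longleftrightarrow> (\<exists>k. k \<subseteq># m' \<and> rel_mset le m k)"

lemma emb_empty [simp]: "emb le {#} m"
  unfolding emb_def by (intro exI[of _ "{#}"]) (simp add: rel_mset_Zero)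

lemma emb_add_mset: "le x y \<Longrightarrow> emb le m m' \<Longrightarrow> emb le (add_mset x m) (add_mset y m')"
  unfolding emb_def by (metis rel_mset_Plus mset_subset_eq_add_mset_cancel)

lemma emb_union:
  assumes "emb le m m'" "emb le n n'"
  shows "emb le (m + n) (m' + n')"
proof -
  obtain k l where k: "k \<subseteq># m'" "rel_mset le m k" and l: "l \<subseteq># n'" "rel_mset le n l"
    using assms unfolding emb_def by blast
  have "rel_mset le (m + n) (k + l)"
    using k(2) l(2)
    by (induction rule: rel_mset_induct) (simp_all add: rel_mset_Plus)
  with k l show ?thesis
    unfolding emb_def by (meson subset_mset.add_mono)
qed

lemma emb_refl: "reflp le \<Longrightarrow> emb le m m"
  by (induction m) (simp_all add: emb_add_mset reflpD)

lemma emb_size: "emb le m m' \<Longrightarrow> size m \<le> size m'"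
  unfolding emb_def using rel_mset_size size_mset_mono by metis

lemma emb_subset_right: "emb le m m' \<Longrightarrow> m' \<subseteq># m'' \<Longrightarrow> emb le m m''"
  unfolding emb_def using subset_mset.order_trans by blast

lemma emb_subset_left:
  assumes "emb le (m + n) m'"
  shows "emb le m m'"
  using assms
proof (induction n)
  case (add x n)
  then obtain k where k: "k \<subseteq># m'" "rel_mset le (add_mset x (m + n)) k"
    unfolding emb_def by auto
  from msed_rel_invL[OF k(2)] obtain y k' where "k = add_mset y k'" "rel_mset le (m + n) k'"
    by blast
  moreover from this k(1) have "k' \<subseteq># m'"
    by (metis mset_subset_eq_insertD subset_mset.less_imp_le)
  ultimately have "emb le (m + n) m'" unfolding emb_def by blast
  then show ?case by (rule add.IH)
qed simp

lemma rel_mset_memR: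
  assumes "rel_mset le m k" "y \<in># k"
  obtains x where "x \<in># m" "le x y"
proof -
  obtain k' where "k = add_mset y k'" using assms(2) by (metis insert_DiffM)
  with assms(1) obtain x m' where "m = add_mset x m'" "le x y"
    using msed_rel_invR by metis
  with that[of x] show ?thesis by simp
qed

lemma emb_trans:
  assumes "transp le" "emb le m m'" "emb le m' m''"
  shows "emb le m m''"
proof -
  obtain k d where k: "m' = k + d" "rel_mset le m k"
    using assms(2) unfolding emb_def by (metis subset_mset.le_iff_add)
  with assms(3) have "emb le k m''" using emb_subset_left by blast
  then obtain k' where k': "k' \<subseteq># m''" "rel_mset le k k'"
    unfolding emb_def by blast
  have "rel_mset (le OO le) m k'"
    using k(2) k'(2) unfolding multiset.rel_compp by blast
  moreover have "le OO le \<le> le" using assms(1) by (auto dest: transpD)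
  ultimately have "rel_mset le m k'"
    using multiset.rel_mono by blast
  with k'(1) show ?thesis unfolding emb_def by blast
qed

lemma transp_emb: "transp le \<Longrightarrow> transp (emb le)"
  by (rule transpI) (rule emb_trans)

text \<open>Let the added \<open>x\<close> on the left be sent to \<open>z\<close>. If some
  \<open>w\<close> in \<open>m\<close> is sent to a copy of \<open>x\<close>, then \<open>w\<close>
  is below \<open>x\<close> and \<open>x\<close> below \<open>z\<close>, so \<open>w\<close> can be
  rerouted to \<open>z\<close>. Otherwise the image of \<open>m\<close> contains no \<open>x\<close>
  and lies in \<open>m'\<close>.\<close>

lemma emb_cancel_add_mset:
  assumes "transp le" "emb le (add_mset x m) (add_mset x m')"
  shows "emb le m m'"
proof -
  obtain k where k: "k \<subseteq># add_mset x m'" "rel_mset le (add_mset x m) k"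
    using assms(2) unfolding emb_def by blast
  from msed_rel_invL[OF k(2)] obtain z k1 where z: "k = add_mset z k1" "le x z" "rel_mset le m k1"
    by blast
  show ?thesis
  proof (cases "x \<in># k1")
    case True
    then obtain k2 where k2: "k1 = add_mset x k2" by (metis insert_DiffM)
    with z(3) obtain w m1 where w: "m = add_mset w m1" "le w x" "rel_mset le m1 k2"
      using msed_rel_invR by metis
    have "le w z" using assms(1) w(2) z(2) by (rule transpD)
    then have "rel_mset le m (add_mset z k2)"
      using w by (simp add: rel_mset_Plus)
    moreover have "add_mset z k2 \<subseteq># m'"
      using k(1) unfolding z(1) k2 by (simp add: add_mset_commute[of z x])
    ultimately show ?thesis unfolding emb_def by blast
  next
    case False
    have "count k1 y \<le> count m' y" for y
      using mset_subset_eq_count[OF k(1), of y] False unfolding z(1)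
      by (cases "x = y") (auto simp: not_in_iff split: if_splits)
    then have "k1 \<subseteq># m'" by (rule mset_subset_eqI)
    with z(3) show ?thesis unfolding emb_def by blast
  qed
qed

lemma emb_cancel:
  assumes "transp le"
  shows "emb le (m + k) (m' + k) \<Longrightarrow> emb le m m'"
  by (induction k) (auto dest: emb_cancel_add_mset[OF assms])

text \<open>An image point lies above some element of \<open>m\<close>, so the image contains no
  element of \<open>n\<close>.\<close>

lemma emb_avoid:
  assumes "emb le m (n + m')" "\<And>x y. x \<in># m \<Longrightarrow> y \<in># n \<Longrightarrow> \<not> le x y"
  shows "emb le m m'"
proof -
  obtain k where k: "k \<subseteq># n + m'" "rel_mset le m k"
    using assms(1) unfolding emb_def by blast
  have disj: "y \<notin># n" if "y \<in># k" for y
    using rel_mset_memR[OF k(2) that] assms(2) by blast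
  have "k \<subseteq># m'"
  proof (rule mset_subset_eqI)
    fix y
    show "count k y \<le> count m' y"
    proof (cases "y \<in># k")
      case True
      then have "count n y = 0" using disj by (simp add: not_in_iff)
      with k(1) show ?thesis by (metis add_0 count_union mset_subset_eq_count)
    qed (simp add: not_in_iff)
  qed
  with k(2) show ?thesis unfolding emb_def by blast
qed

section \<open>Agreement with the embedding by injections between copies\<close>

lemma mset_copies_add: "mset_copies (add_mset x m) = insert (x, count m x) (mset_copies m)"
  by (auto simp: mset_copies_def not_in_iff less_Suc_eq split: if_splits)

lemma finite_mset_copies [simp]: "finite (mset_copies m)"
  by (simp add: mset_copies_def)

lemma image_fst_mset_copies: "image_mset fst (mset_set (mset_copies m)) = m"
proof (induction m)
  case (add x m)
  have "(x, count m x) \<notin> mset_copies m" by (simp add: mset_copies_def)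
  with add show ?case by (simp add: mset_copies_add)
qed (simp add: mset_copies_def)

lemma mset_embeds_iff_emb: "mset_embeds le m m' \<longleftrightarrow> emb le m m'"
proof
  assume "mset_embeds le m m'"
  then obtain f where f: "inj_on f (mset_copies m)" "f ` mset_copies m \<subseteq> mset_copies m'"
    "\<And>p. p \<in> mset_copies m \<Longrightarrow> le (fst p) (fst (f p))"
    unfolding mset_embeds_def by blast
  let ?S = "mset_set (mset_copies m)"
  have "image_mset fst (mset_set (f ` mset_copies m)) \<subseteq># image_mset fst (mset_set (mset_copies m'))"
    using f(2) by (intro image_mset_subseteq_mono subset_imp_msubset_mset_set) simp_all
  then have "image_mset (\<lambda>p. fst (f p)) ?S \<subseteq># m'"
    by (simp add: image_mset_mset_set[OF f(1), symmetric] image_fst_mset_copies multiset.map_comp comp_def)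
  moreover have "rel_mset le (image_mset fst ?S) (image_mset (\<lambda>p. fst (f p)) ?S)"
    unfolding multiset.rel_map by (rule multiset.rel_refl_strong) (simp add: f(3))
  ultimately show "emb le m m'"
    unfolding emb_def image_fst_mset_copies by blast
next
  assume "emb le m m'"
  then obtain k where k: "k \<subseteq># m'" "rel_mset le m k"
    unfolding emb_def by blast
  have "\<exists>f. inj_on f (mset_copies m) \<and> f ` mset_copies m \<subseteq> mset_copies k \<and>
      (\<forall>p\<in>mset_copies m. le (fst p) (fst (f p)))"
    using k(2)
  proof (induction rule: rel_mset_induct)
    case (add le x y m k)
    from add.IH obtain f where f: "inj_on f (mset_copies m)" "f ` mset_copies m \<subseteq> mset_copies k"
      "\<forall>p\<in>mset_copies m. le (fst p) (fst (f p))" by (elim exE conjE)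
    \<comment> \<open>Copies are numbered from 0, so the copy gained by \<open>add_mset x m\<close>
      is the pair with index \<open>count m x\<close>.\<close>
    have new: "(x, count m x) \<notin> mset_copies m" "(y, count k y) \<notin> mset_copies k"
      by (simp_all add: mset_copies_def)
    let ?f = "f((x, count m x) := (y, count k y))"
    have im: "?f ` mset_copies m = f ` mset_copies m"
      using new by (intro image_cong) auto
    have inj: "inj_on ?f (mset_copies m)"
      using f(1) new by (subst inj_on_cong[of _ ?f f]) auto
    show ?case
      unfolding mset_copies_add
    proof (intro exI[of _ ?f] conjI)
      have "(y, count k y) \<notin> ?f ` mset_copies m"
        using im f(2) new(2) by blast
      with inj show "inj_on ?f (insert (x, count m x) (mset_copies m))"
        using new(1) by simp
      show "?f ` insert (x, count m x) (mset_copies m) \<subseteq> insert (y, count k y) (mset_copies k)"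
        using im f(2) by (simp del: fun_upd_apply) auto
      show "\<forall>p\<in>insert (x, count m x) (mset_copies m). le (fst p) (fst (?f p))"
        using f(3) add.hyps by simp
    qed
  qed (simp add: mset_copies_def)
  moreover have "mset_copies k \<subseteq> mset_copies m'"
    using k(1) mset_subset_eq_count[OF k(1)]
    by (auto simp: mset_copies_def dest: mset_subset_eqD less_le_trans)
  ultimately show "mset_embeds le m m'"
    unfolding mset_embeds_def by blast
qed

section \<open>Ranks of sets of multisets\<close>

lemma nat_add_cnf_val [simp]: "nat_add (cnf_val M) (cnf_val N) = cnf_val (M + N)"
  by (simp add: nat_add_def)

lemma multisets_over_empty [simp]: "multisets_over {} = {{#}}"
  by (auto simp: multisets_over_def)

lemma empty_in_multisets_over [simp]: "{#} \<in> multisets_over X"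
  by (simp add: multisets_over_def)

section \<open>Maximal order type of multisets: upper bound\<close>

abbreviation (input) hat_exponent :: "'a ordinal multiset \<Rightarrow> 'a ordinal" where
  "hat_exponent M \<equiv> cnf_val (image_mset prime_exponent M)"

text \<open>Both parts of the residual stay below one indecomposable ordinal. Multisets without an
  element above \<open>x\<close> do so because \<open>prime_exponent\<close> is strictly monotone.
  For the others the exponents are \<open>nat_add c q\<close> with
  \<open>q < omega_pow (prime_exponent c)\<close>, and \<open>c\<close> is below that same power; at
  epsilon-numbers this is due to the shift.\<close>

lemma rank_le_multisets_indecomposable:
  fixes c :: "'a ordinal"
  assumes le: "reflp le" "transp le" and X: "rank_le (bad le) X (omega_pow c)"
    and IH: "\<And>M A. M < {#c#} \<Longrightarrow> rank_le (bad le) A (cnf_val M) \<Longrightarrow>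
      rank_le (bad (emb le)) (multisets_over A) (omega_pow (hat_exponent M))"
    and m: "m \<in> multisets_over X"
  shows "\<exists>\<beta>. \<beta> < omega_pow (omega_pow (prime_exponent c)) \<and>
    rank_le (bad (emb le)) (residual (bad (emb le)) (multisets_over X) m) \<beta>"
  using m
proof (induction m)
  case empty
  show ?case by (intro exI[of _ 0]) simp
next
  case (add x m)
  let ?c = "omega_pow (prime_exponent c)"
  let ?R = "\<lambda>m. residual (bad (emb le)) (multisets_over X) m"
  let ?Y = "{m' \<in> ?R (add_mset x m). \<exists>y\<in>#m'. le x y}"
  have x: "x \<in> X" "m \<in> multisets_over X"
    using add.prems by (auto simp: multisets_over_def)
  obtain \<alpha> where \<alpha>: "\<alpha> < omega_pow c" "rank_le (bad le) (residual (bad le) X x) \<alpha>"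
    using rank_leD[OF X x(1)] by blast
  define M where "M = cnf \<alpha>"
  have M: "M < {#c#}" "rank_le (bad le) (residual (bad le) X x) (cnf_val M)"
    using \<alpha> by (simp_all add: M_def flip: cnf_val_less_iff)
  have low: "rank_le (bad (emb le)) (multisets_over (residual (bad le) X x)) (omega_pow (hat_exponent M))"
    by (rule IH[OF M])
  have lowlt: "omega_pow (hat_exponent M) < omega_pow ?c"
    using M(1) by (auto simp: cnf_val_less_omega_pow_iff prime_exponent_strict_mono simp flip: cnf_val_less_iff)
  obtain \<beta> where \<beta>: "\<beta> < omega_pow ?c" "rank_le (bad (emb le)) (?R m) \<beta>"
    using add.IH x(2) by blast
  define N where "N = cnf \<beta>"
  have N: "\<forall>q\<in>#N. q < ?c" "rank_le (bad (emb le)) (?R m) (cnf_val N)"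
    using \<beta> by (simp_all add: N_def less_omega_pow_iff_cnf)
  \<comment> \<open>The element above \<open>x\<close> that is removed. The pair of
    \<open>f m'\<close> and the rest of \<open>m'\<close> puts \<open>?Y\<close> under the product
    bound.\<close>
  define f where "f m' = (SOME y. y \<in># m' \<and> le x y)" for m'
  have f: "f m' \<in># m' \<and> le x (f m')" if "m' \<in> ?Y" for m'
    unfolding f_def by (rule someI_ex) (use that in blast)
  have "rank_le (bad (emb le)) ?Y (cnf_val (exponent_products {#c#} N))"
  proof (rule rank_le_product[OF le(2) transp_emb[OF le(2)] _ N(2)])
    show "rank_le (bad le) X (cnf_val {#c#})" using X by simp
    show "f ` ?Y \<subseteq> X" using f by (auto simp: multisets_over_def)
    show "(\<lambda>m'. m' - {#f m'#}) ` ?Y \<subseteq> ?R m"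
    proof
      fix n assume "n \<in> (\<lambda>m'. m' - {#f m'#}) ` ?Y"
      then obtain m' where m': "m' \<in> ?Y" "n = m' - {#f m'#}" by blast
      have "\<not> emb le m n"
      proof
        assume "emb le m n"
        then have "emb le (add_mset x m) (add_mset (f m') n)"
          using f[OF m'(1)] by (simp add: emb_add_mset)
        then show False using m' f[OF m'(1)] by simp
      qed
      then show "n \<in> ?R m"
        using m' by (auto simp: multisets_over_def dest: in_diffD)
    qed
    fix y y' assume y: "y \<in> ?Y" "y' \<in> ?Y" "\<not> emb le y y'"
    show "\<not> le (f y) (f y') \<or> \<not> emb le (y - {#f y#}) (y' - {#f y'#})"
      using emb_add_mset[of le "f y" "f y'" "y - {#f y#}" "y' - {#f y'#}"] f[OF y(1)] f[OF y(2)] y(3)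
      by auto
  qed
  then have "rank_le (bad (emb le)) (multisets_over (residual (bad le) X x) \<union> ?Y)
      (nat_add (omega_pow (hat_exponent M)) (cnf_val (exponent_products {#c#} N)))"
    by (rule rank_le_Un[OF low])
  then have "rank_le (bad (emb le)) (?R (add_mset x m))
      (nat_add (omega_pow (hat_exponent M)) (cnf_val (exponent_products {#c#} N)))"
    by (rule rank_le_subset) (auto simp: multisets_over_def)
  moreover have "cnf_val (exponent_products {#c#} N) < omega_pow ?c"
    using N(1) by (auto simp: cnf_val_less_omega_pow_iff in_exponent_products_iff
        intro!: nat_add_less_omega_pow less_omega_pow_prime_exponent)
  ultimately show ?case
    using nat_add_less_omega_pow[OF lowlt] by blast
qed

text \<open>A cut of \<open>X\<close> splits every multiset into two restrictions, whose embeddings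
  combine. The product of two powers of omega adds their exponents naturally, which is the union of
  the shifted normal forms.\<close>

theorem rank_le_multisets:
  fixes M :: "'a ordinal multiset"
  assumes le: "reflp le" "transp le" and "rank_le (bad le) X (cnf_val M)"
  shows "rank_le (bad (emb le)) (multisets_over X) (omega_pow (hat_exponent M))"
  using assms(3)
proof (induction M arbitrary: X rule: less_induct)
  case (less M)
  show ?case
  proof (cases "M = {#}")
    case True
    with less.prems have "X = {}" by simp
    have "rank_le (bad (emb le)) {{#}} (1 :: 'a ordinal)"
      by (rule rank_leI) (rule exI[of _ 0], simp)
    with \<open>X = {}\<close> show ?thesis by (simp add: True)
  next
    case False
    then obtain Z c where M: "M = Z + {#c#}" "\<And>z. z \<in># Z \<Longrightarrow> c \<le> z"
      using split_min_mset by blast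
    show ?thesis
    proof (cases "Z = {#}")
      case True
      with M have M: "M = {#c#}" by simp
      have X: "rank_le (bad le) X (omega_pow c)"
        using less.prems by (simp add: M)
      have "rank_le (bad (emb le)) (multisets_over X) (omega_pow (omega_pow (prime_exponent c)))"
        by (rule rank_leI) (rule rank_le_multisets_indecomposable[OF le X less.IH], simp_all add: M)
      then show ?thesis by (simp add: M)
    next
      case Z: False
      have "cnf_val M = cnf_val Z + cnf_val {#c#}"
        unfolding M(1) by (rule cnf_val_add) (use M(2) in auto)
      then obtain A where A: "A \<subseteq> X" "rank_le (bad le) A (cnf_val Z)" "rank_le (bad le) (X - A) (cnf_val {#c#})"
        using rank_le_split[OF le(2)] less.prems by metis
      have "rank_le (bad (emb le)) (multisets_over A) (cnf_val {#hat_exponent Z#})"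
        using less.IH[OF _ A(2)] by (simp add: M)
      moreover have "rank_le (bad (emb le)) (multisets_over (X - A)) (cnf_val {#hat_exponent {#c#}#})"
        using less.IH[OF _ A(3)] Z by (simp add: M)
      ultimately have "rank_le (bad (emb le)) (multisets_over X)
        (cnf_val (exponent_products {#hat_exponent Z#} {#hat_exponent {#c#}#}))"
      proof (rule rank_le_product[OF transp_emb[OF le(2)] transp_emb[OF le(2)]])
        show "filter_mset (\<lambda>x. x \<in> A) ` multisets_over X \<subseteq> multisets_over A"
          "filter_mset (\<lambda>x. x \<notin> A) ` multisets_over X \<subseteq> multisets_over (X - A)"
          by (auto simp: multisets_over_def)
        fix y y' assume "\<not> emb le y y'"
        then show "\<not> emb le (filter_mset (\<lambda>x. x \<in> A) y) (filter_mset (\<lambda>x. x \<in> A) y') \<or>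
            \<not> emb le (filter_mset (\<lambda>x. x \<notin> A) y) (filter_mset (\<lambda>x. x \<notin> A) y')"
          using emb_union multiset_partition by metis
      qed
      then show ?thesis
        by (simp only: exponent_products_simps nat_add_cnf_val cnf_val_single M(1) image_mset_union)
    qed
  qed
qed

section \<open>Blocks of multisets along a bad sequence\<close>

abbreviation (input) incomparable :: "('b \<Rightarrow> 'b \<Rightarrow> bool) \<Rightarrow> 'b \<Rightarrow> 'b \<Rightarrow> bool" where
  "incomparable le \<equiv> \<lambda>x y. \<not> le x y \<and> \<not> le y x"

text \<open>If an earlier \<open>u' + m'\<close> embedded into \<open>m + u\<close>, the part
  \<open>u'\<close> would avoid \<open>m\<close> and embed into \<open>u\<close>, against badness.
  Inside a block the common \<open>u\<close> cancels.\<close>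

lemma rank_ge_multisets_Un:
  fixes \<alpha> \<beta> :: "'a ordinal"
  assumes le: "reflp le" "transp le" and AU: "\<forall>a\<in>A. \<forall>u\<in>U. \<not> le u a"
    and A: "rank_ge (bad (emb le)) (multisets_over A) \<alpha>"
    and U: "rank_ge (bad (emb le)) (multisets_over U) \<beta>"
  shows "rank_ge (bad (emb le)) (multisets_over (A \<union> U)) (\<alpha> * \<beta>)"
proof (rule rank_ge_lex[OF _ _ U])
  let ?B = "\<lambda>u. (\<lambda>m. m + u) ` multisets_over A"
  show "?B u \<subseteq> multisets_over (A \<union> U)" if "u \<in> multisets_over U" for u
    using that by (auto simp: multisets_over_def)
  fix u S
  assume u: "u \<in> multisets_over U"
    and S: "\<And>s. s \<in> S \<Longrightarrow> \<exists>u'\<in>multisets_over U. s \<in> ?B u' \<and> \<not> emb le u' u"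
  have "rank_ge (bad (emb le)) (?B u) \<alpha>"
    by (rule rank_ge_map[OF A, of "\<lambda>m. m + u"]) (auto dest: emb_cancel[OF le(2)])
  moreover have "\<not> emb le s y" if s: "s \<in> S" and y: "y \<in> ?B u" for s y
  proof
    assume emb: "emb le s y"
    obtain u' m' where u': "u' \<in> multisets_over U" "\<not> emb le u' u" "s = u' + m'"
      using S[OF s] by (auto simp: add.commute)
    obtain m where m: "m \<in> multisets_over A" "y = m + u" using y by auto
    have "emb le u' (m + u)"
      using emb unfolding u'(3) m(2) by (rule emb_subset_left)
    then have "emb le u' u"
      by (rule emb_avoid) (use AU u'(1) m(1) in \<open>auto simp: multisets_over_def\<close>)
    with u'(2) show False by simp
  qed
  ultimately show "\<exists>B'\<subseteq>?B u. rank_ge (bad (emb le)) B' \<alpha> \<and> (\<forall>s\<in>S. \<forall>y\<in>B'. \<not> emb le s y)"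
    by blast
qed

text \<open>A block is moved out of the reach of the finitely many earlier multisets by adding sufficiently
  many copies of a fixed element of \<open>A\<close>.\<close>

lemma rank_ge_antichain_multisets_Un:
  fixes \<alpha> \<beta> :: "'a ordinal"
  assumes le: "reflp le" "transp le" and AU: "\<forall>a\<in>A. \<forall>u\<in>U. \<not> le u a"
    and "A \<noteq> {}"
    and A: "rank_ge (incomparable (emb le)) (multisets_over A) \<alpha>"
    and U: "rank_ge (bad (emb le)) (multisets_over U) \<beta>"
  shows "rank_ge (incomparable (emb le)) (multisets_over (A \<union> U)) (\<alpha> * \<beta>)"
proof (rule rank_ge_lex[OF _ _ U])
  let ?B = "\<lambda>u. (\<lambda>m. m + u) ` multisets_over A"
  show "?B u \<subseteq> multisets_over (A \<union> U)" if "u \<in> multisets_over U" for u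
    using that by (auto simp: multisets_over_def)
  obtain c where c: "c \<in> A" using \<open>A \<noteq> {}\<close> by blast
  fix u S
  assume u: "u \<in> multisets_over U" and "finite S"
    and S: "\<And>s. s \<in> S \<Longrightarrow> \<exists>u'\<in>multisets_over U. s \<in> ?B u' \<and> \<not> emb le u' u"
  \<comment> \<open>Larger than all earlier sizes, so nothing in the shifted block embeds into an
    earlier multiset. The inserted 0 keeps \<open>Max\<close> defined when \<open>S\<close> is
    empty.\<close>
  define N where "N = Suc (Max (insert 0 (size ` S)))"
  have N: "size s < N" if "s \<in> S" for s
    unfolding N_def using that \<open>finite S\<close> by (auto simp: less_Suc_eq_le intro: Max_ge)
  define r where "r = replicate_mset N c + u"
  let ?B' = "(\<lambda>m. m + r) ` multisets_over A"
  have "?B' \<subseteq> ?B u"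
  proof
    fix y assume "y \<in> ?B'"
    then obtain m where "m \<in> multisets_over A" "y = m + r" by blast
    then have "m + replicate_mset N c \<in> multisets_over A" "y = (m + replicate_mset N c) + u"
      using c by (auto simp: multisets_over_def r_def split: if_splits)
    then show "y \<in> ?B u" by blast
  qed
  moreover have "rank_ge (incomparable (emb le)) ?B' \<alpha>"
    by (rule rank_ge_map[OF A, of "\<lambda>m. m + r"]) (auto dest: emb_cancel[OF le(2)])
  moreover have "\<not> emb le s y \<and> \<not> emb le y s" if s: "s \<in> S" and y: "y \<in> ?B'" for s y
  proof (intro conjI notI)
    assume "emb le y s"
    moreover have "N \<le> size y" using y by (auto simp: r_def)
    ultimately show False using N[OF s] emb_size[of le y s] by simp
  next
    assume emb: "emb le s y"
    obtain u' m' where u': "u' \<in> multisets_over U" "\<not> emb le u' u" "s = u' + m'"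
      using S[OF s] by (auto simp: add.commute)
    obtain m where m: "m \<in> multisets_over A" "y = m + u"
      using y \<open>?B' \<subseteq> ?B u\<close> by blast
    have "emb le u' (m + u)"
      using emb unfolding u'(3) m(2) by (rule emb_subset_left)
    then have "emb le u' u"
      by (rule emb_avoid) (use AU u'(1) m(1) in \<open>auto simp: multisets_over_def\<close>)
    with u'(2) show False by simp
  qed
  ultimately show "\<exists>B'\<subseteq>?B u. rank_ge (incomparable (emb le)) B' \<alpha> \<and>
      (\<forall>s\<in>S. \<forall>y\<in>B'. \<not> emb le s y \<and> \<not> emb le y s)"
    by blast
qed

section \<open>Maximal order type of multisets: lower bound\<close>

lemma rank_ge_limit:
  fixes \<alpha> :: "'a ordinal"
  assumes "\<And>\<gamma>. \<gamma> < \<alpha> \<Longrightarrow> \<exists>\<beta>. \<gamma> < \<beta> \<and> rank_ge P Y \<beta>"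
  shows "rank_ge P Y \<alpha>"
proof (rule rank_geI)
  fix \<gamma> assume "\<gamma> < \<alpha>"
  then obtain \<beta> where "\<gamma> < \<beta>" "rank_ge P Y \<beta>" using assms by blast
  then show "\<exists>y\<in>Y. rank_ge P (residual P Y y) \<gamma>" by (blast dest: rank_geD)
qed

lemma rank_ge_nat: "rank_ge (\<lambda>i j :: nat. \<not> i \<le> j) {..<n} (ordinal_of_nat n :: 'a ordinal)"
proof (induction n rule: less_induct)
  case (less n)
  show ?case
  proof (rule rank_geI)
    fix \<beta> :: "'a ordinal" assume "\<beta> < ordinal_of_nat n"
    then obtain k where k: "k < n" "\<beta> = ordinal_of_nat k"
      unfolding less_ordinal_of_nat_iff by blast
    have "residual (\<lambda>i j. \<not> i \<le> j) {..<n} k = {..<k}" using k by auto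
    with less.IH[OF k(1)] k(1) show
      "\<exists>y\<in>{..<n}. rank_ge (\<lambda>i j. \<not> i \<le> j) (residual (\<lambda>i j. \<not> i \<le> j) {..<n} y) \<beta>"
      unfolding k(2) by (intro bexI[of _ k]) simp_all
  qed
qed

text \<open>A decreasing number of copies of \<open>x\<close> is a bad sequence, and its first term
  can be as large as desired.\<close>

lemma rank_ge_multisets_omega:
  fixes x :: 'b
  assumes "x \<in> X"
  shows "rank_ge (bad (emb le)) (multisets_over X) (omega :: 'a ordinal)"
proof (rule rank_ge_limit)
  fix \<gamma> :: "'a ordinal" assume "\<gamma> < omega"
  then obtain k where "\<gamma> = ordinal_of_nat k" by (auto simp: less_omega_iff)
  then have "\<gamma> < ordinal_of_nat (Suc k)" by simp
  moreover have "rank_ge (bad (emb le)) (multisets_over X) (ordinal_of_nat (Suc k) :: 'a ordinal)"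
  proof (rule rank_ge_map[OF rank_ge_nat, of "\<lambda>n. replicate_mset n x"])
    show "(\<lambda>n. replicate_mset n x) ` {..<Suc k} \<subseteq> multisets_over X"
      using assms by (auto simp: multisets_over_def split: if_splits)
    show "\<not> emb le (replicate_mset i x) (replicate_mset j x)" if "\<not> i \<le> j" for i j
      using emb_size[of le "replicate_mset i x" "replicate_mset j x"] that by auto
  qed
  ultimately show "\<exists>\<beta>. \<gamma> < \<beta> \<and> rank_ge (bad (emb le)) (multisets_over X) \<beta>" by blast
qed

text \<open>Settles exponents that are not shifted. A point \<open>x\<close> whose residual has rank
  at least \<open>\<delta>\<close> contributes the factor \<open>omega\<close>, because the set
  above it contains \<open>x\<close> itself.\<close>

lemma rank_ge_multisets_omega_pow:
  fixes \<alpha> :: "'a ordinal"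
  assumes le: "reflp le" "transp le" and X: "rank_ge (bad le) X \<alpha>"
  shows "rank_ge (bad (emb le)) (multisets_over X) (omega_pow \<alpha>)"
  using X
proof (induction \<alpha> arbitrary: X rule: less_induct)
  case (less \<alpha>)
  show ?case
  proof (rule rank_ge_limit)
    fix \<gamma> assume "\<gamma> < omega_pow \<alpha>"
    then consider "\<gamma> = 0" | \<delta> where "\<delta> < \<alpha>" "\<gamma> < omega_pow \<delta> * omega"
      unfolding less_omega_pow_iff[of _ \<alpha>] by blast
    then show "\<exists>\<beta>. \<gamma> < \<beta> \<and> rank_ge (bad (emb le)) (multisets_over X) \<beta>"
    proof cases
      case 1
      have "rank_ge (bad (emb le)) (multisets_over X) (1 :: 'a ordinal)"
        by (rule rank_ge_1) (use empty_in_multisets_over in blast)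
      with 1 show ?thesis using zero_less_one_ordinal by blast
    next
      case 2
      obtain x where x: "x \<in> X" "rank_ge (bad le) (residual (bad le) X x) \<delta>"
        using rank_geD[OF less.prems 2(1)] by blast
      let ?L = "residual (bad le) X x" and ?U = "{y \<in> X. le x y}"
      have "rank_ge (bad (emb le)) (multisets_over (?L \<union> ?U)) (omega_pow \<delta> * omega)"
      proof (rule rank_ge_multisets_Un[OF le])
        show "rank_ge (bad (emb le)) (multisets_over ?L) (omega_pow \<delta>)"
          by (rule less.IH[OF 2(1) x(2)])
        show "rank_ge (bad (emb le)) (multisets_over ?U) omega"
          by (rule rank_ge_multisets_omega[of x]) (use x(1) le(1) in \<open>auto dest: reflpD\<close>)
        show "\<forall>a\<in>?L. \<forall>u\<in>?U. \<not> le u a"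
          using le(2) by (auto dest: transpD)
      qed
      moreover have "?L \<union> ?U = X" by auto
      ultimately show ?thesis using 2(2) by metis
    qed
  qed
qed

text \<open>The blocks are indexed by the least element \<open>x\<close>; the other \<open>k\<close>
  elements are taken above \<open>x\<close>. The set above \<open>x\<close> still has rank at least
  \<open>omega_pow c\<close>: its complement in \<open>A\<close> has smaller rank, and
  \<open>omega_pow c\<close> is not a natural sum of two smaller ordinals.\<close>

lemma rank_ge_sized_multisets:
  fixes c \<rho> :: "'a ordinal"
  assumes le: "reflp le" "transp le"
    and X: "rank_le (bad le) X \<rho>" "rank_ge (bad le) X (omega_pow c)"
  shows "rank_ge (bad (emb le)) {m \<in> multisets_over X. size m = k} (omega_pow (c * ordinal_of_nat k))"
  using X
proof (induction k arbitrary: X)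
  case 0
  have "{#} \<in> {m \<in> multisets_over X. size m = 0}" by simp
  then have "rank_ge (bad (emb le)) {m \<in> multisets_over X. size m = 0} (1 :: 'a ordinal)"
    by (intro rank_ge_1) blast
  then show ?case by simp
next
  case (Suc k)
  \<comment> \<open>\<open>X\<close> may have larger rank; only in a part of rank exactly
    \<open>omega_pow c\<close> are all residuals smaller than \<open>omega_pow c\<close>.\<close>
  obtain A where A: "A \<subseteq> X" "rank_le (bad le) A (omega_pow c)" "rank_ge (bad le) A (omega_pow c)"
    by (rule rank_node[OF le(2) Suc.prems])
  let ?U = "\<lambda>x. {y \<in> A. le x y}"
  let ?M = "\<lambda>x. {m \<in> multisets_over (?U x). size m = k}"
  have sub: "rank_ge (bad (emb le)) (?M x) (omega_pow (c * ordinal_of_nat k))" if x: "x \<in> A" for x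
  proof (rule Suc.IH)
    show "rank_le (bad le) (?U x) \<rho>"
      by (rule rank_le_subset[OF Suc.prems(1)]) (use A(1) in auto)
    obtain \<beta> where \<beta>: "\<beta> < omega_pow c" "rank_le (bad le) (residual (bad le) A x) \<beta>"
      using rank_leD[OF A(2) x] by blast
    have "rank_le (bad le) (?U x) (omega_pow c)"
      by (rule rank_le_subset[OF A(2)]) auto
    then obtain \<upsilon> :: "'a ordinal" where \<upsilon>: "rank_le (bad le) (?U x) \<upsilon>" "rank_ge (bad le) (?U x) \<upsilon>"
      using rank_exact by blast
    have "rank_le (bad le) (residual (bad le) A x \<union> ?U x) (nat_add \<beta> \<upsilon>)"
      using \<beta>(2) \<upsilon>(1) by (rule rank_le_Un)
    moreover have "residual (bad le) A x \<union> ?U x = A" by auto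
    ultimately have "omega_pow c \<le> nat_add \<beta> \<upsilon>"
      using rank_ge_le[OF A(3)] by metis
    then have "\<not> \<upsilon> < omega_pow c"
      using nat_add_less_omega_pow[OF \<beta>(1), of \<upsilon>] by (meson leD)
    then show "rank_ge (bad le) (?U x) (omega_pow c)"
      by (intro rank_ge_mono[OF \<upsilon>(2)]) simp
  qed
  have "rank_ge (bad (emb le)) {m \<in> multisets_over X. size m = Suc k}
      (omega_pow (c * ordinal_of_nat k) * omega_pow c)"
  proof (rule rank_ge_lex[OF _ _ A(3)])
    show "add_mset x ` ?M x \<subseteq> {m \<in> multisets_over X. size m = Suc k}" if "x \<in> A" for x
      using that A(1) unfolding multisets_over_def by fastforce
    fix x S
    assume x: "x \<in> A" and S: "\<And>s. s \<in> S \<Longrightarrow> \<exists>x'\<in>A. s \<in> add_mset x' ` ?M x' \<and> \<not> le x' x"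
    have "rank_ge (bad (emb le)) (add_mset x ` ?M x) (omega_pow (c * ordinal_of_nat k))"
      by (rule rank_ge_map[OF sub[OF x], of "add_mset x"]) (auto dest: emb_cancel_add_mset[OF le(2)])
    moreover have "\<not> emb le s y" if s: "s \<in> S" and y: "y \<in> add_mset x ` ?M x" for s y
    proof
      assume "emb le s y"
      then obtain n where n: "n \<subseteq># y" "rel_mset le s n" unfolding emb_def by blast
      obtain x' m' where x': "\<not> le x' x" "s = add_mset x' m'" "m' \<in> ?M x'"
        using S[OF s] by blast
      \<comment> \<open>Equal sizes make the embedding onto, so \<open>x\<close> is hit by some
        \<open>z\<close> of \<open>s\<close>. The least element \<open>x'\<close> of
        \<open>s\<close> would then be below \<open>x\<close>.\<close>
      have "size n = size y" using rel_mset_size[OF n(2)] x' y by auto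
      with n(1) have "n = y"
        by (metis mset_subset_size subset_mset.le_imp_less_or_eq less_irrefl)
      with y have "x \<in># n" by auto
      then obtain z where z: "z \<in># s" "le z x" using rel_mset_memR[OF n(2)] by blast
      then have "le x' z" using x' le(1) by (auto simp: multisets_over_def dest: reflpD)
      with z(2) x'(1) le(2) show False by (auto dest: transpD)
    qed
    ultimately show "\<exists>B'\<subseteq>add_mset x ` ?M x.
        rank_ge (bad (emb le)) B' (omega_pow (c * ordinal_of_nat k)) \<and> (\<forall>s\<in>S. \<forall>y\<in>B'. \<not> emb le s y)"
      by blast
  qed
  moreover have "omega_pow (c * ordinal_of_nat (Suc k)) \<le> omega_pow (c * ordinal_of_nat k) * omega_pow c"
    using omega_pow_add_le[of "c * ordinal_of_nat k" c] by (simp add: times_distrib_ordinal)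
  ultimately show ?case by (rule rank_ge_mono)
qed

text \<open>The shifted exponents are an epsilon-number itself, or \<open>d + 1\<close> with
  \<open>d\<close> already shifted to \<open>d + 1\<close>. The two kinds require different lower
  bound arguments.\<close>

lemma prime_exponent_cases:
  obtains "prime_exponent c = c" | "prime_exponent c = c + 1" "omega_pow c = c"
  | d where "c = d + 1" "prime_exponent d = c" "prime_exponent c = c + 1"
proof (cases "\<exists>\<epsilon> n. epsilon_number \<epsilon> \<and> n < omega \<and> c = \<epsilon> + n")
  case False
  then have "prime_exponent c = c" unfolding prime_exponent_def by (rule if_not_P)
  then show ?thesis by (rule that(1))
next
  case True
  then obtain \<epsilon> n where \<epsilon>: "epsilon_number \<epsilon>" "c = \<epsilon> + ordinal_of_nat n"
    by (auto simp: less_omega_iff)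
  have prime: "prime_exponent (\<epsilon> + ordinal_of_nat k) = \<epsilon> + ordinal_of_nat k + 1" for k
    by (rule prime_exponent_eqI[OF \<epsilon>(1) _ refl]) (auto simp: less_omega_iff)
  show ?thesis
  proof (cases n)
    case 0
    then show ?thesis using that(2) prime[of n] \<epsilon> by (simp add: epsilon_number_def)
  next
    case (Suc k)
    then show ?thesis
      using that(3)[of "\<epsilon> + ordinal_of_nat k"] prime[of k] prime[of "Suc k"] \<epsilon>(2) by (simp add: add.assoc)
  qed
qed

text \<open>For \<open>\<upsilon> < omega_pow c\<close> the natural sum of \<open>cnf_val Z\<close>
  and \<open>\<upsilon>\<close> is too small, so the complement keeps the full last term.\<close>

lemma rank_ge_split_cnf:
  fixes Z :: "'a ordinal multiset" and \<rho> :: "'a ordinal"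
  assumes "transp le" "rank_le (bad le) X \<rho>" "rank_ge (bad le) X (cnf_val (Z + {#c#}))"
  obtains A where "A \<subseteq> X" "rank_ge (bad le) A (cnf_val Z)"
    "rank_ge (bad le) (X - A) (omega_pow c)" "\<forall>a\<in>A. \<forall>u\<in>X - A. \<not> le u a"
proof -
  have le: "cnf_val Z \<le> cnf_val (Z + {#c#})"
    by (simp only: cnf_val_le_iff) (rule subset_eq_imp_le_multiset, simp)
  have less: "nat_add (cnf_val Z) \<upsilon> < cnf_val (Z + {#c#})" if "\<upsilon> < omega_pow c" for \<upsilon>
    using nat_add_strict_mono(2)[OF that, of "cnf_val Z"] nat_add_cnf_val[of Z "{#c#}"] by simp
  obtain A where "A \<subseteq> X" "rank_le (bad le) A (cnf_val Z)" "rank_ge (bad le) A (cnf_val Z)"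
    "rank_ge (bad le) (X - A) (omega_pow c)" "\<forall>a\<in>A. \<forall>u\<in>X - A. \<not> le u a"
    by (rule rank_ge_split[OF assms(1,2,3) le less])
  then show ?thesis by (intro that)
qed

theorem rank_ge_multisets:
  fixes M :: "'a ordinal multiset" and \<rho> :: "'a ordinal"
  assumes le: "reflp le" "transp le"
    and "rank_le (bad le) X \<rho>" "rank_ge (bad le) X (cnf_val M)"
  shows "rank_ge (bad (emb le)) (multisets_over X) (omega_pow (hat_exponent M))"
  using assms(3,4)
proof (induction M arbitrary: X rule: less_induct)
  case (less M)
  show ?case
  proof (cases "M = {#}")
    case True
    have "rank_ge (bad (emb le)) (multisets_over X) (1 :: 'a ordinal)"
      by (rule rank_ge_1) (use empty_in_multisets_over in blast)
    then show ?thesis by (simp add: True)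
  next
    case False
    then obtain Z c where M: "M = Z + {#c#}" "\<And>z. z \<in># Z \<Longrightarrow> c \<le> z"
      using split_min_mset by blast
    show ?thesis
    proof (cases "Z = {#}")
      case True
      with M have M: "M = {#c#}" by simp
      have X: "rank_ge (bad le) X (omega_pow c)" using less.prems(2) by (simp add: M)
      \<comment> \<open>The target is the supremum of the powers with exponent
        \<open>omega_pow c * ordinal_of_nat k\<close>, so it suffices to reach each of
        these.\<close>
      have lim: "rank_ge (bad (emb le)) (multisets_over X) (omega_pow (omega_pow (c + 1)))"
        if *: "\<And>k. rank_ge (bad (emb le)) (multisets_over X) (omega_pow (omega_pow c * ordinal_of_nat k))"
      proof (rule rank_ge_limit)
        fix \<gamma> assume "\<gamma> < omega_pow (omega_pow (c + 1))"
        then obtain \<delta> n where \<delta>: "\<delta> < omega_pow (c + 1)" "\<gamma> < omega_pow \<delta> * ordinal_of_nat n"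
          using less_omega_powE[OF _ omega_pow_neq_0] by blast
        from \<delta>(1) obtain k where "\<delta> < omega_pow c * ordinal_of_nat k"
          unfolding less_omega_pow_add_one_iff by blast
        with \<delta>(2) have "\<gamma> < omega_pow (omega_pow c * ordinal_of_nat k)"
          using omega_pow_times_less less_trans by blast
        with * show "\<exists>\<beta>. \<gamma> < \<beta> \<and> rank_ge (bad (emb le)) (multisets_over X) \<beta>" by blast
      qed
      consider "prime_exponent c = c" | "prime_exponent c = c + 1" "omega_pow c = c"
        | d where "c = d + 1" "prime_exponent d = c" "prime_exponent c = c + 1"
        by (rule prime_exponent_cases)
      then show ?thesis
      proof cases
        case 1
        with rank_ge_multisets_omega_pow[OF le X] show ?thesis by (simp add: M)
      next
        case 2
        \<comment> \<open>At an epsilon-number \<open>omega_pow c\<close> equals \<open>c\<close>,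
          and multisets of size \<open>k\<close> reach the required exponent.\<close>
        have "rank_ge (bad (emb le)) (multisets_over X) (omega_pow (omega_pow c * ordinal_of_nat k))" for k
          unfolding 2(2) by (rule rank_ge_superset[OF rank_ge_sized_multisets[OF le less.prems(1) X]]) auto
        with lim show ?thesis by (simp add: M 2(1))
      next
        case 3
        have "rank_ge (bad (emb le)) (multisets_over X) (omega_pow (omega_pow c * ordinal_of_nat k))" for k
        proof -
          \<comment> \<open>Each \<open>omega_pow d * ordinal_of_nat k\<close> is below
            \<open>omega_pow (d + 1)\<close>, so the induction hypothesis covers \<open>k\<close>
            copies of \<open>d\<close>, whose shifted exponents are all \<open>c\<close>.\<close>
          have lt: "cnf_val (replicate_mset k d) < cnf_val M"
            unfolding M cnf_val_replicate cnf_val_single by (rule omega_pow_times_less) (simp add: 3(1))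
          have "rank_ge (bad le) X (cnf_val (replicate_mset k d))"
            using less.prems(2) by (rule rank_ge_mono) (use lt in simp)
          then have "rank_ge (bad (emb le)) (multisets_over X) (omega_pow (hat_exponent (replicate_mset k d)))"
            using lt less.prems(1) by (intro less.IH) simp_all
          then show ?thesis by (simp add: 3(2) cnf_val_replicate)
        qed
        with lim show ?thesis by (simp add: M 3(3))
      qed
    next
      case Z: False
      obtain A where A: "A \<subseteq> X" "rank_ge (bad le) A (cnf_val Z)" "rank_ge (bad le) (X - A) (omega_pow c)"
        "\<forall>a\<in>A. \<forall>u\<in>X - A. \<not> le u a"
        by (rule rank_ge_split_cnf[OF le(2) less.prems(1) less.prems(2)[unfolded M(1)]])
      have wf: "rank_le (bad le) A \<rho>" "rank_le (bad le) (X - A) \<rho>"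
        using less.prems(1) A(1) by (auto elim: rank_le_subset)
      have "rank_ge (bad (emb le)) (multisets_over (A \<union> (X - A)))
          (omega_pow (hat_exponent Z) * omega_pow (hat_exponent {#c#}))"
      proof (rule rank_ge_multisets_Un[OF le])
        show "rank_ge (bad (emb le)) (multisets_over A) (omega_pow (hat_exponent Z))"
          by (rule less.IH[OF _ wf(1) A(2)]) (simp add: M(1))
        show "rank_ge (bad (emb le)) (multisets_over (X - A)) (omega_pow (hat_exponent {#c#}))"
          by (rule less.IH[OF _ wf(2)]) (use A(3) Z in \<open>simp_all add: M(1)\<close>)
      qed (use A(4) in blast)
      moreover have "A \<union> (X - A) = X" using A(1) by auto
      moreover have "hat_exponent M = hat_exponent Z + hat_exponent {#c#}"
        unfolding M(1) image_mset_union by (rule cnf_val_add) (auto dest: M(2) prime_exponent_mono)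
      ultimately show ?thesis
        using omega_pow_add_le rank_ge_mono by metis
    qed
  qed
qed

section \<open>Width: lower bound\<close>

text \<open>Peeling off the smallest exponent \<open>c\<close> appends
  \<open>omega_pow (prime_exponent c)\<close> on the right of the exponent obtained for
  \<open>Z\<close>. The missing 1 thus stays at the far left, with the leading term, and is lost
  only once.\<close>

theorem rank_ge_antichain_multisets:
  fixes M :: "'a ordinal multiset" and \<rho> :: "'a ordinal"
  assumes le: "reflp le" "transp le"
    and "rank_le (bad le) X \<rho>" "rank_ge (bad le) X (cnf_val M)" "M \<noteq> {#}" "1 + \<gamma> = hat_exponent M"
  shows "rank_ge (incomparable (emb le)) (multisets_over X) (omega_pow \<gamma>)"
  using assms(3-)
proof (induction M arbitrary: X \<gamma> rule: less_induct)
  case (less M)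
  obtain Z c where M: "M = Z + {#c#}" "\<And>z. z \<in># Z \<Longrightarrow> c \<le> z"
    using less.prems(3) split_min_mset by blast
  have one: "rank_ge (incomparable (emb le)) (multisets_over A) (1 :: 'a ordinal)" for A
    by (rule rank_ge_1) (use empty_in_multisets_over in blast)
  have block: "rank_ge (incomparable (emb le)) (multisets_over X) (\<alpha> * omega_pow (omega_pow (prime_exponent c)))"
    if A: "A \<subseteq> X" "rank_ge (bad le) (X - A) (omega_pow c)" "\<forall>a\<in>A. \<forall>u\<in>X - A. \<not> le u a"
      "A \<noteq> {}" "rank_ge (incomparable (emb le)) (multisets_over A) \<alpha>" for A and \<alpha> :: "'a ordinal"
  proof -
    have wf: "rank_le (bad le) (X - A) \<rho>"
      using less.prems(1) by (auto elim: rank_le_subset)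
    have "rank_ge (bad (emb le)) (multisets_over (X - A)) (omega_pow (hat_exponent {#c#}))"
      by (rule rank_ge_multisets[OF le wf]) (use A(2) in simp)
    then have "rank_ge (incomparable (emb le)) (multisets_over (A \<union> (X - A)))
        (\<alpha> * omega_pow (omega_pow (prime_exponent c)))"
      by (intro rank_ge_antichain_multisets_Un[OF le]) (use A in auto)
    moreover have "A \<union> (X - A) = X" using A(1) by auto
    ultimately show ?thesis by simp
  qed
  show ?case
  proof (cases "Z = {#}")
    case True
    with M have M: "M = {#c#}" by simp
    have X: "rank_ge (bad le) X (omega_pow c)" using less.prems(2) by (simp add: M)
    show ?thesis
    proof (cases "c = 0")
      case True
      with less.prems(4) M have "1 + \<gamma> = 1 + 0" by simp
      then have "\<gamma> = 0" by (simp only: add_left_cancel_ordinal)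
      with one show ?thesis by simp
    next
      case False
      then have c: "0 < c" by (simp add: zero_less_ordinal_iff)
      \<comment> \<open>For \<open>c > 0\<close> a set of rank 1 is cut off to serve as the nonempty
        lower part. By indecomposability the rest keeps rank \<open>omega_pow c\<close>, and the 1
        is absorbed.\<close>
      have less1: "nat_add 1 \<upsilon> < omega_pow c" if "\<upsilon> < omega_pow c" for \<upsilon>
        by (rule nat_add_less_omega_pow[OF _ that]) (use c omega_pow_strict_mono[of 0 c] in simp)
      have "1 \<le> omega_pow c" by (simp add: one_le_ordinal_iff)
      then obtain A where A: "A \<subseteq> X" "rank_le (bad le) A (1 :: 'a ordinal)" "rank_ge (bad le) A (1 :: 'a ordinal)"
        "rank_ge (bad le) (X - A) (omega_pow c)"
        "\<forall>a\<in>A. \<forall>u\<in>X - A. \<not> le u a"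
        by (rule rank_ge_split[OF le(2) less.prems(1) X _ less1])
      have "A \<noteq> {}" using rank_ge_nonempty[OF A(3)] by (simp flip: one_le_ordinal_iff)
      then have "rank_ge (incomparable (emb le)) (multisets_over X) (1 * omega_pow (omega_pow (prime_exponent c)))"
        by (intro block[OF A(1,4,5)] one)
      moreover have "1 + \<gamma> = 1 + omega_pow (prime_exponent c)"
      proof -
        have "1 < omega_pow (prime_exponent c)"
          using omega_pow_strict_mono[of 0 "prime_exponent c"] c prime_exponent_ge[of c] by simp
        then have "1 + omega_pow (prime_exponent c) = omega_pow (prime_exponent c)"
          by (rule add_omega_pow_absorb)
        with less.prems(4) show ?thesis by (simp add: M)
      qed
      ultimately show ?thesis by simp
    qed
  next
    case Z: False
    obtain A where A: "A \<subseteq> X" "rank_ge (bad le) A (cnf_val Z)" "rank_ge (bad le) (X - A) (omega_pow c)"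
      "\<forall>a\<in>A. \<forall>u\<in>X - A. \<not> le u a"
      by (rule rank_ge_split_cnf[OF le(2) less.prems(1) less.prems(2)[unfolded M(1)]])
    have pos: "cnf_val Z \<noteq> 0" "hat_exponent Z \<noteq> 0"
      using Z by (simp_all flip: cnf_val_empty)
    then obtain \<delta> where \<delta>: "hat_exponent Z = 1 + \<delta>"
      using le_imp_add_ordinal one_le_ordinal_iff by metis
    have "Z < M" by (simp add: M(1))
    moreover have "rank_le (bad le) A \<rho>"
      using less.prems(1) A(1) by (rule rank_le_subset)
    ultimately have "rank_ge (incomparable (emb le)) (multisets_over A) (omega_pow \<delta>)"
      by (rule less.IH[OF _ _ A(2) Z \<delta>[symmetric]])
    then have ge: "rank_ge (incomparable (emb le)) (multisets_over X)
        (omega_pow \<delta> * omega_pow (omega_pow (prime_exponent c)))"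
      by (intro block[OF A(1,3,4)] rank_ge_nonempty[OF A(2) pos(1)])
    have "hat_exponent M = hat_exponent Z + hat_exponent {#c#}"
      unfolding M(1) image_mset_union by (rule cnf_val_add) (auto dest: M(2) prime_exponent_mono)
    then have "1 + \<gamma> = 1 + (\<delta> + omega_pow (prime_exponent c))"
      using less.prems(4) \<delta> by (simp add: add.assoc)
    then have "\<gamma> = \<delta> + omega_pow (prime_exponent c)" by (simp only: add_left_cancel_ordinal)
    then show ?thesis
      using rank_ge_mono[OF ge omega_pow_add_le] by simp
  qed
qed

section \<open>Width: upper bound\<close>

text \<open>In a piece of rank at most 1 every residual is empty, so any two elements are below each
  other, and antisymmetry leaves at most one.\<close>

lemma finite_if_rank_le_nat:
  assumes le: "reflp le" "transp le" "antisymp le"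
    and "rank_le (bad le) X (ordinal_of_nat n :: 'a ordinal)"
  shows "finite X \<and> card X \<le> n"
  using assms(4)
proof (induction n arbitrary: X)
  case (Suc n)
  then have "rank_le (bad le) X (ordinal_of_nat n + 1 :: 'a ordinal)" by simp
  then obtain A where A: "A \<subseteq> X" "rank_le (bad le) A (ordinal_of_nat n :: 'a ordinal)"
    "rank_le (bad le) (X - A) (1 :: 'a ordinal)"
    by (rule rank_le_split[OF le(2)])
  have all: "le u v" if "u \<in> X - A" "v \<in> X - A" for u v
  proof -
    have "residual (bad le) (X - A) u = {}"
      using rank_leD[OF A(3) that(1)] by auto
    with that(2) show ?thesis by blast
  qed
  have "finite (X - A) \<and> card (X - A) \<le> 1"
  proof (cases "X - A = {}")
    case False
    then obtain u where u: "u \<in> X - A" by blast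
    then have "X - A \<subseteq> {u}"
      using all antisympD[OF le(3)] by blast
    then show ?thesis
      using card_mono[of "{u}" "X - A"] finite_subset[of "X - A" "{u}"] by simp
  qed (simp only: finite.emptyI card.empty simp_thms zero_le_one)
  moreover have "finite A" "card A \<le> n" using Suc.IH[OF A(2)] by simp_all
  moreover have X: "X = A \<union> (X - A)" using A(1) by auto
  ultimately show ?case
    using card_Un_le[of A "X - A"] by (metis add_mono finite_UnI le_trans Suc_eq_plus1)
qed simp

text \<open>Inclusion is the embedding for the discrete order. For reflexive \<open>le\<close> it
  implies \<open>emb le\<close>, so this bounds the width for every order on \<open>X\<close>. The
  base case has rank 1 because multisets over one point form a chain.\<close>

lemma rank_le_multisets_finite:
  assumes "card X = Suc n"
  shows "rank_le (incomparable (\<subseteq>#)) (multisets_over X) (omega_pow (ordinal_of_nat n) :: 'a ordinal)"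
  using assms
proof (induction n arbitrary: X)
  case 0
  then obtain x where x: "X = {x}" by (auto simp: card_Suc_eq)
  have comparable: "m \<subseteq># m' \<or> m' \<subseteq># m" if "m \<in> multisets_over X" "m' \<in> multisets_over X" for m m'
  proof -
    have zero: "count m y = 0" "count m' y = 0" if "y \<noteq> x" for y
      using \<open>m \<in> _\<close> \<open>m' \<in> _\<close> that by (auto simp: multisets_over_def x not_in_iff[symmetric])
    show ?thesis
    proof (cases "count m x \<le> count m' x")
      case True
      then have "count m y \<le> count m' y" for y using zero[of y] by (cases "y = x") simp_all
      then show ?thesis by (auto intro: mset_subset_eqI)
    next
      case False
      then have "count m' y \<le> count m y" for y using zero[of y] by (cases "y = x") simp_all
      then show ?thesis by (auto intro: mset_subset_eqI)
    qed
  qed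
  have "rank_le (incomparable (\<subseteq>#)) (multisets_over X) (1 :: 'a ordinal)"
  proof (rule rank_leI)
    fix m assume m: "m \<in> multisets_over X"
    have "residual (incomparable (\<subseteq>#)) (multisets_over X) m = {}"
      using comparable[OF m] by blast
    then have "rank_le (incomparable (\<subseteq>#)) (residual (incomparable (\<subseteq>#)) (multisets_over X) m) (0 :: 'a ordinal)"
      by (simp only: rank_le_0_iff)
    then show "\<exists>\<beta><(1 :: 'a ordinal).
        rank_le (incomparable (\<subseteq>#)) (residual (incomparable (\<subseteq>#)) (multisets_over X) m) \<beta>"
      using zero_less_one_ordinal by blast
  qed
  then show ?case by simp
next
  case (Suc n)
  show ?case
  proof (rule rank_leI)
    fix m assume m: "m \<in> multisets_over X"
    \<comment> \<open>Slices with a prescribed multiplicity \<open>v\<close> of \<open>x\<close>.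
      Finitely many cover the residual, and a finite union of sets of rank at most
      \<open>omega_pow (ordinal_of_nat n)\<close> stays below the next power.\<close>
    define S where "S = (\<lambda>(x, v). {m' \<in> multisets_over X. count m' x = v})"
    define I where "I = (SIGMA x : X. {..<count m x})"
    have "finite X" using Suc.prems card.infinite by fastforce
    then have "finite I" by (simp add: I_def)
    moreover have "\<exists>\<beta>. \<beta> < omega_pow (ordinal_of_nat (Suc n) :: 'a ordinal) \<and>
        rank_le (incomparable (\<subseteq>#)) (S i) \<beta>" if "i \<in> I" for i
    proof (intro exI conjI)
      obtain x v where i: "i = (x, v)" "x \<in> X" using \<open>i \<in> I\<close> by (auto simp: I_def)
      have "card (X - {x}) = Suc n" using Suc.prems i(2) by simp
      note IH = Suc.IH[OF this]
      show "omega_pow (ordinal_of_nat n) < omega_pow (ordinal_of_nat (Suc n) :: 'a ordinal)" by simp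
      show "rank_le (incomparable (\<subseteq>#)) (S i) (omega_pow (ordinal_of_nat n) :: 'a ordinal)"
      proof (rule rank_le_map[OF IH])
        show "filter_mset (\<lambda>y. y \<noteq> x) ` S i \<subseteq> multisets_over (X - {x})"
          by (auto simp: S_def i multisets_over_def)
        have sub: "k \<subseteq># k'" if "k \<in> S i" "k' \<in> S i"
          "filter_mset (\<lambda>y. y \<noteq> x) k \<subseteq># filter_mset (\<lambda>y. y \<noteq> x) k'" for k k'
        proof (rule mset_subset_eqI)
          fix y
          show "count k y \<le> count k' y"
            using that(1,2) mset_subset_eq_count[OF that(3), of y]
            by (cases "y = x") (auto simp: S_def i)
        qed
        fix k k' assume "k \<in> S i" "k' \<in> S i" "\<not> k \<subseteq># k' \<and> \<not> k' \<subseteq># k"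
        then show "\<not> filter_mset (\<lambda>y. y \<noteq> x) k \<subseteq># filter_mset (\<lambda>y. y \<noteq> x) k' \<and>
            \<not> filter_mset (\<lambda>y. y \<noteq> x) k' \<subseteq># filter_mset (\<lambda>y. y \<noteq> x) k"
          using sub by blast
      qed
    qed
    ultimately obtain \<beta> where \<beta>: "\<beta> < omega_pow (ordinal_of_nat (Suc n) :: 'a ordinal)"
      "rank_le (incomparable (\<subseteq>#)) (\<Union>i\<in>I. S i) \<beta>"
      using rank_le_UN[of I "ordinal_of_nat (Suc n) :: 'a ordinal" "incomparable (\<subseteq>#)" S] by blast
    have "residual (incomparable (\<subseteq>#)) (multisets_over X) m \<subseteq> (\<Union>i\<in>I. S i)"
    proof
      fix m' assume m': "m' \<in> residual (incomparable (\<subseteq>#)) (multisets_over X) m"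
      then have "\<not> m \<subseteq># m'" by blast
      then obtain x where x: "count m' x < count m x"
        using mset_subset_eqI[of m m'] not_less by blast
      then have "x \<in># m" by (metis not_in_iff not_less_zero)
      with x m m' have "(x, count m' x) \<in> I" "m' \<in> S (x, count m' x)"
        by (auto simp: I_def S_def multisets_over_def)
      then show "m' \<in> (\<Union>i\<in>I. S i)" by blast
    qed
    with \<beta> show "\<exists>\<beta>. \<beta> < omega_pow (ordinal_of_nat (Suc n) :: 'a ordinal) \<and>
        rank_le (incomparable (\<subseteq>#)) (residual (incomparable (\<subseteq>#)) (multisets_over X) m) \<beta>"
      by (blast intro: rank_le_subset)
  qed
qed

theorem rank_le_antichain_multisets:
  fixes M :: "'a ordinal multiset"
  assumes le: "reflp le" "transp le" "antisymp le"
    and X: "rank_le (bad le) X (cnf_val M)" "X \<noteq> {}" and \<gamma>: "1 + \<gamma> = hat_exponent M"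
  shows "rank_le (incomparable (emb le)) (multisets_over X) (omega_pow \<gamma>)"
proof (cases "cnf_val M < omega")
  case True
  then obtain n where n: "cnf_val M = ordinal_of_nat n" by (auto simp: less_omega_iff)
  then have "M = replicate_mset n 0" by (simp add: ordinal_of_nat_eq_cnf_val)
  then have hat: "hat_exponent M = ordinal_of_nat n" by (simp add: ordinal_of_nat_eq_cnf_val)
  have fin: "finite X" "card X \<le> n"
    using finite_if_rank_le_nat[OF le] X(1) n by metis+
  then obtain k where k: "card X = Suc k" using X(2) by (metis card_gt_0_iff gr0_implies_Suc)
  with fin(2) obtain l where l: "n = Suc l" "k \<le> l" by (cases n) auto
  have "\<gamma> = ordinal_of_nat l"
    using \<gamma> unfolding hat l(1) one_plus_ordinal_of_nat[symmetric] by simp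
  with l(2) have exp: "omega_pow (ordinal_of_nat k) \<le> omega_pow \<gamma>"
    by (simp add: ordinal_of_nat_mono)
  have "rank_le (incomparable (emb le)) (multisets_over X) (omega_pow (ordinal_of_nat k) :: 'a ordinal)"
  proof (rule rank_le_map[OF rank_le_multisets_finite[OF k], of id])
    show "id ` multisets_over X \<subseteq> multisets_over X" by simp
    show "\<not> id m \<subseteq># id m' \<and> \<not> id m' \<subseteq># id m" if "\<not> emb le m m' \<and> \<not> emb le m' m" for m m'
      using that emb_subset_right[OF emb_refl[OF le(1)]] by auto
  qed
  then show ?thesis using exp by (rule rank_le_mono)
next
  case False
  then obtain \<beta> where \<beta>: "\<beta> \<in># M" "1 \<le> \<beta>"
    unfolding omega_pow_one[symmetric] cnf_val_less_omega_pow_iff by (meson not_less)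
  from \<beta>(2) have "1 \<le> prime_exponent \<beta>"
    using prime_exponent_ge by (rule order.trans)
  then have "\<not> prime_exponent \<beta> < 1" by (rule leD)
  with \<beta>(1) have "\<not> hat_exponent M < omega"
    unfolding omega_pow_one[symmetric] cnf_val_less_omega_pow_iff by (simp del: less_one_ordinal_iff) blast
  \<comment> \<open>An infinite \<open>hat_exponent M\<close> absorbs the 1, so the bound for bad
    sequences already has the right exponent.\<close>
  then have "1 + \<gamma> = 1 + hat_exponent M" using \<gamma> by (simp add: one_plus_infinite)
  then have "\<gamma> = hat_exponent M" by (simp only: add_left_cancel_ordinal)
  with rank_le_multisets[OF le(1,2) X(1)]
  have "rank_le (bad (emb le)) (multisets_over X) (omega_pow \<gamma>)" by simp
  then show ?thesis by (rule rank_le_map[of _ _ _ id]) simp_all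
qed

section \<open>Trees of sequences\<close>

lemma tree_rank_unfold:
  "wf R \<Longrightarrow> tree_rank R s = lsub (tree_rank R ` {t. (t, s) \<in> R})"
  unfolding tree_rank_def by (subst wfrec, assumption) (auto simp: cut_apply intro: arg_cong[of _ _ lsub] image_cong)

text \<open>Common form of \<open>bad_seqs\<close> and \<open>antichains\<close>.\<close>

definition seqs :: "('b \<Rightarrow> 'b \<Rightarrow> bool) \<Rightarrow> 'b set \<Rightarrow> 'b list set" where
  "seqs P Y = {s. set s \<subseteq> Y \<and> sorted_wrt P s}"

definition extensions :: "('b \<Rightarrow> 'b \<Rightarrow> bool) \<Rightarrow> 'b set \<Rightarrow> 'b list \<Rightarrow> 'b set" where
  "extensions P Y s = {y \<in> Y. \<forall>x\<in>set s. P x y}"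

lemma extensions_Nil [simp]: "extensions P Y [] = Y"
  by (simp add: extensions_def)

lemma extensions_snoc: "extensions P Y (s @ [y]) = residual P (extensions P Y s) y"
  by (auto simp: extensions_def)

lemma predecessors_extension_rel:
  "s \<in> seqs P Y \<Longrightarrow> {t. (t, s) \<in> extension_rel (seqs P Y)} = (\<lambda>y. s @ [y]) ` extensions P Y s"
  by (auto simp: extension_rel_def seqs_def extensions_def sorted_wrt_append)

lemma snoc_in_seqs: "s \<in> seqs P Y \<Longrightarrow> y \<in> extensions P Y s \<Longrightarrow> s @ [y] \<in> seqs P Y"
  by (auto simp: seqs_def extensions_def sorted_wrt_append)

lemma wf_extension_rel_if_rank_le:
  assumes "rank_le P Y \<alpha>"
  shows "wf (extension_rel (seqs P Y))"
proof -
  let ?R = "extension_rel (seqs P Y)"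
  have acc: "s \<in> Wellfounded.acc ?R" if "s \<in> seqs P Y" "rank_le P (extensions P Y s) \<beta>" "\<beta> \<le> \<alpha>" for s \<beta>
    using that
  proof (induction \<beta> arbitrary: s rule: less_induct)
    case (less \<beta>)
    show ?case
    proof (rule accI)
      fix t assume "(t, s) \<in> ?R"
      then obtain y where y: "y \<in> extensions P Y s" "t = s @ [y]"
        using predecessors_extension_rel[OF less.prems(1)] by blast
      obtain \<beta>' where \<beta>': "\<beta>' < \<beta>" "rank_le P (extensions P Y (s @ [y])) \<beta>'"
        using rank_leD[OF less.prems(2) y(1)] unfolding extensions_snoc by blast
      show "t \<in> Wellfounded.acc ?R"
        unfolding y(2)
        by (rule less.IH[OF \<beta>'(1) snoc_in_seqs[OF less.prems(1) y(1)] \<beta>'(2)]) (use \<beta>'(1) less.prems(3) in simp)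
    qed
  qed
  have "s \<in> Wellfounded.acc ?R" for s
  proof (cases "s \<in> seqs P Y")
    case True
    have "rank_le P (extensions P Y s) \<alpha>"
      by (rule rank_le_subset[OF assms]) (auto simp: extensions_def)
    then show ?thesis using acc[OF True] by blast
  next
    case False
    show ?thesis by (rule accI) (use False in \<open>auto simp: extension_rel_def\<close>)
  qed
  then show ?thesis by (auto simp: wf_iff_acc)
qed

text \<open>The nodes may have any type, so no cardinality argument shows that the ranks of the
  extensions have a strict bound; it is derived from \<open>\<delta>\<close> instead.\<close>

lemma tree_rank_eqI:
  fixes \<delta> :: "'a ordinal"
  assumes "rank_le P Y \<delta>" "rank_ge P Y \<delta>"
  shows "tree_rank (extension_rel (seqs P Y)) [] = \<delta>"
proof -
  let ?R = "extension_rel (seqs P Y)"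
  let ?E = "extensions P Y"
  have unfold: "(tree_rank ?R s :: 'a ordinal) = lsub ((\<lambda>y. tree_rank ?R (s @ [y])) ` ?E s)"
    if "s \<in> seqs P Y" for s
    using tree_rank_unfold[OF wf_extension_rel_if_rank_le[OF assms(1)], of s]
    unfolding predecessors_extension_rel[OF that] image_image .
  have upper: "tree_rank ?R s \<le> \<alpha>" if "s \<in> seqs P Y" "rank_le P (?E s) \<alpha>" for s and \<alpha> :: "'a ordinal"
    using that
  proof (induction \<alpha> arbitrary: s rule: less_induct)
    case (less \<alpha>)
    show ?case
      unfolding unfold[OF less.prems(1)]
    proof (rule lsub_least)
      fix \<xi> :: "'a ordinal" assume "\<xi> \<in> (\<lambda>y. tree_rank ?R (s @ [y])) ` ?E s"
      then obtain y where y: "y \<in> ?E s" "\<xi> = tree_rank ?R (s @ [y])" by blast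
      obtain \<beta> where \<beta>: "\<beta> < \<alpha>" "rank_le P (?E (s @ [y])) \<beta>"
        using rank_leD[OF less.prems(2) y(1)] unfolding extensions_snoc by blast
      have "\<xi> \<le> \<beta>"
        unfolding y(2) by (rule less.IH[OF \<beta>(1) snoc_in_seqs[OF less.prems(1) y(1)] \<beta>(2)])
      with \<beta>(1) show "\<xi> < \<alpha>" by simp
    qed
  qed
  have lower: "\<alpha> \<le> tree_rank ?R s" if "s \<in> seqs P Y" "rank_ge P (?E s) \<alpha>" for s and \<alpha> :: "'a ordinal"
    using that
  proof (induction \<alpha> arbitrary: s rule: less_induct)
    case (less \<alpha>)
    let ?S = "(\<lambda>y. tree_rank ?R (s @ [y])) ` ?E s :: 'a ordinal set"
    \<comment> \<open>Existence of this bound makes the \<open>LEAST\<close> in \<open>lsub\<close>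
      genuine.\<close>
    have "\<forall>\<xi>\<in>?S. \<xi> < \<delta> + 1"
    proof
      fix \<xi> assume "\<xi> \<in> ?S"
      then obtain y where y: "y \<in> ?E s" "\<xi> = tree_rank ?R (s @ [y])" by blast
      have "rank_le P (?E (s @ [y])) \<delta>"
        by (rule rank_le_subset[OF assms(1)]) (auto simp: extensions_def)
      then show "\<xi> < \<delta> + 1"
        using upper[OF snoc_in_seqs[OF less.prems(1) y(1)]] y(2) by simp
    qed
    then have bound: "\<forall>\<xi>\<in>?S. \<xi> < lsub ?S"
      unfolding lsub_def by (rule LeastI)
    show ?case
    proof (rule ord_leI)
      fix \<beta> assume \<beta>: "\<beta> < \<alpha>"
      then obtain y where y: "y \<in> ?E s" "rank_ge P (?E (s @ [y])) \<beta>"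
        using rank_geD[OF less.prems(2)] unfolding extensions_snoc by blast
      have "\<beta> \<le> tree_rank ?R (s @ [y])"
        by (rule less.IH[OF \<beta> snoc_in_seqs[OF less.prems(1) y(1)] y(2)])
      also have "\<dots> < tree_rank ?R s"
        unfolding unfold[OF less.prems(1)] using bound y(1) by blast
      finally show "\<beta> < tree_rank ?R s" .
    qed
  qed
  have "[] \<in> seqs P Y" by (simp add: seqs_def)
  with upper[of "[]" \<delta>] lower[of "[]" \<delta>] assms show ?thesis by (simp add: order.antisym)
qed

text \<open>Here elements and ordinals share the type \<open>'a\<close>, so each node has few enough
  extensions for \<open>lsub\<close>. This gives access to \<open>max_order_type\<close> when no
  bound is known beforehand.\<close>

lemma rank_tree_rank:
  fixes Y :: "'a set"
  assumes "wf (extension_rel (seqs P Y))"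
  defines "\<rho> \<equiv> tree_rank (extension_rel (seqs P Y)) [] :: 'a ordinal"
  shows "rank_le P Y \<rho>" "rank_ge P Y \<rho>"
proof -
  let ?R = "extension_rel (seqs P Y)"
  let ?E = "extensions P Y"
  have "|UNIV :: 'a set| \<le>o |UNIV :: ('a + nat) set|"
    by (rule card_of_ordLeqI[of Inl]) auto
  moreover have "|A| \<le>o |UNIV :: 'a set|" for A :: "'a set"
    by (rule card_of_mono1) simp
  ultimately have small: "|A| \<le>o |UNIV :: ('a + nat) set|" for A :: "'a set"
    using ordLeq_transitive by blast
  have "rank_le P (?E s) (tree_rank ?R s :: 'a ordinal) \<and> rank_ge P (?E s) (tree_rank ?R s :: 'a ordinal)"
    if "s \<in> seqs P Y" for s
    using assms(1) that
  proof (induction s rule: wf_induct_rule)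
    case (less s)
    let ?S = "(\<lambda>y. tree_rank ?R (s @ [y])) ` ?E s :: 'a ordinal set"
    have unfold: "tree_rank ?R s = lsub ?S"
      using tree_rank_unfold[OF assms(1), of s]
      unfolding predecessors_extension_rel[OF less.prems] image_image .
    have S: "|?S| \<le>o |UNIV :: ('a + nat) set|"
      by (rule small_image) (rule small)
    have IH: "rank_le P (residual P (?E s) y) (tree_rank ?R (s @ [y]) :: 'a ordinal)"
      "rank_ge P (residual P (?E s) y) (tree_rank ?R (s @ [y]) :: 'a ordinal)" if "y \<in> ?E s" for y
    proof -
      have "(s @ [y], s) \<in> ?R"
        using predecessors_extension_rel[OF less.prems] that by blast
      from less.IH[OF this snoc_in_seqs[OF less.prems that]]
      show "rank_le P (residual P (?E s) y) (tree_rank ?R (s @ [y]) :: 'a ordinal)"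
        "rank_ge P (residual P (?E s) y) (tree_rank ?R (s @ [y]) :: 'a ordinal)"
        by (simp_all add: extensions_snoc)
    qed
    show ?case
      unfolding unfold
    proof
      show "rank_le P (?E s) (lsub ?S)"
        by (rule rank_leI) (use IH(1) lsub_greater[OF S] in blast)
      show "rank_ge P (?E s) (lsub ?S)"
      proof (rule rank_geI)
        fix \<beta> assume "\<beta> < lsub ?S"
        then obtain y where y: "y \<in> ?E s" "\<beta> \<le> tree_rank ?R (s @ [y])"
          unfolding less_lsub_iff[OF S] by blast
        then show "\<exists>y\<in>?E s. rank_ge P (residual P (?E s) y) \<beta>"
          using rank_ge_mono[OF IH(2)[OF y(1)] y(2)] by blast
      qed
    qed
  qed
  from this[of "[]"] show "rank_le P Y \<rho>" "rank_ge P Y \<rho>"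
    by (simp_all add: \<rho>_def seqs_def)
qed

lemma wf_bad_seqs:
  assumes "\<not> (\<exists>x :: nat \<Rightarrow> 'b. range x \<subseteq> Y \<and> (\<forall>i j. i < j \<longrightarrow> P (x i) (x j)))"
  shows "wf (extension_rel (seqs P Y))"
proof (rule ccontr)
  assume "\<not> wf (extension_rel (seqs P Y))"
  then obtain f where f: "\<And>i. (f (Suc i), f i) \<in> extension_rel (seqs P Y)"
    unfolding wf_iff_no_infinite_down_chain by blast
  \<comment> \<open>The entry appended at step \<open>i\<close>. An infinite descending chain grows
    by one entry each time, so these entries form an infinite admissible sequence.\<close>
  define x where "x i = last (f (Suc i))" for i
  have step: "f (Suc i) = f i @ [x i]" "f (Suc i) \<in> seqs P Y" for i
    using f[of i] by (auto simp: extension_rel_def x_def)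
  have mem: "x i \<in> set (f j)" if "i < j" for i j
    using that by (induction j) (auto simp: step(1) less_Suc_eq)
  have "P (x i) (x j)" if "i < j" for i j
    using step(2)[of j] mem[OF that] unfolding step(1) by (auto simp: seqs_def sorted_wrt_append)
  moreover have "range x \<subseteq> Y"
    using step by (auto simp: seqs_def)
  ultimately show False using assms by blast
qed

lemma emb_mono_on:
  assumes "emb le m m'" "\<And>x y. x \<in># m \<Longrightarrow> y \<in># m' \<Longrightarrow> le x y \<Longrightarrow> le' x y"
  shows "emb le' m m'"
proof -
  obtain k where k: "k \<subseteq># m'" "rel_mset le m k"
    using assms(1) unfolding emb_def by blast
  have "rel_mset le' m k"
    by (rule multiset.rel_mono_strong[OF k(2)]) (use assms(2) mset_subset_eqD[OF k(1)] in blast)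
  with k(1) show ?thesis unfolding emb_def by blast
qed

theorem mainTheorem1:
  fixes X :: "'a set" and le :: "'a \<Rightarrow> 'a \<Rightarrow> bool"
  assumes "wpo_on X le" and "X \<noteq> {}"
  shows "(width (multisets_over X) (mset_embeds le) :: 'a ordinal) =
    omega_pow (minus_one (ordinal_hat (max_order_type X le :: 'a ordinal)))"
proof -
  \<comment> \<open>The earlier results assume reflexivity, transitivity and antisymmetry on the
    whole type; \<open>le'\<close> keeps \<open>le\<close> on \<open>X\<close> and is equality
    elsewhere.\<close>
  define le' where "le' x y \<longleftrightarrow> x = y \<or> x \<in> X \<and> y \<in> X \<and> le x y" for x y
  have wpo: "reflp_on X le" "transp_on X le" "antisymp_on X le"
    "\<not> (\<exists>x :: nat \<Rightarrow> 'a. range x \<subseteq> X \<and> (\<forall>i j. i < j \<longrightarrow> bad le (x i) (x j)))"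
    using assms(1) by (simp_all add: wpo_on_def)
  have eq: "le' x y \<longleftrightarrow> le x y" if "x \<in> X" "y \<in> X" for x y
    using that reflp_onD[OF wpo(1)] by (auto simp: le'_def)
  have "reflp le'" by (rule reflpI) (simp add: le'_def)
  moreover have "transp le'"
    unfolding le'_def transp_def using transp_onD[OF wpo(2)] by blast
  moreover have "antisymp le'"
    unfolding le'_def antisymp_def using antisymp_onD[OF wpo(3)] by blast
  ultimately have le': "reflp le'" "transp le'" "antisymp le'" .
  define M where "M = cnf (max_order_type X le :: 'a ordinal)"
  have rank: "max_order_type X le = tree_rank (extension_rel (seqs (bad le) X)) []"
    by (simp add: max_order_type_def bad_seqs_def seqs_def)
  note ranks = rank_tree_rank[OF wf_bad_seqs[OF wpo(4)], folded rank]
  have X: "rank_le (bad le') X (cnf_val M)" "rank_ge (bad le') X (cnf_val M)"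
    unfolding M_def cnf_val_cnf
    by (rule rank_le_map[OF ranks(1), of id], simp_all add: eq)
      (rule rank_ge_map[OF ranks(2), of id], simp_all add: eq)
  have "M \<noteq> {#}" using X(1) assms(2) by auto
  then have "hat_exponent M \<noteq> 0" by (simp flip: cnf_val_empty)
  then obtain \<gamma> where \<gamma>: "1 + \<gamma> = hat_exponent M"
    using le_imp_add_ordinal one_le_ordinal_iff by metis
  have embeds: "mset_embeds le m m' \<longleftrightarrow> emb le' m m'"
    if "m \<in> multisets_over X" "m' \<in> multisets_over X" for m m'
  proof -
    have "le' x y \<longleftrightarrow> le x y" if "x \<in># m" "y \<in># m'" for x y
      using that \<open>m \<in> _\<close> \<open>m' \<in> _\<close> by (intro eq) (auto simp: multisets_over_def)
    then show ?thesis
      unfolding mset_embeds_iff_emb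
      using emb_mono_on[of le m m' le'] emb_mono_on[of le' m m' le] by blast
  qed
  let ?P = "incomparable (mset_embeds le)"
  have "rank_le ?P (multisets_over X) (omega_pow \<gamma>)"
    by (rule rank_le_map[OF rank_le_antichain_multisets[OF le' X(1) assms(2) \<gamma>], of id])
      (simp_all add: embeds)
  moreover have "rank_ge ?P (multisets_over X) (omega_pow \<gamma>)"
    by (rule rank_ge_map[OF rank_ge_antichain_multisets[OF le'(1,2) X \<open>M \<noteq> {#}\<close> \<gamma>], of id])
      (simp_all add: embeds)
  ultimately have "width (multisets_over X) (mset_embeds le) = omega_pow \<gamma>"
    unfolding width_def antichains_def seqs_def[symmetric] by (rule tree_rank_eqI)
  moreover have "minus_one (ordinal_hat (max_order_type X le)) = \<gamma>"
    using minus_one_eqI[OF \<gamma>] ordinal_hat_cnf_val[of M] by (simp add: M_def)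
  ultimately show ?thesis by simp
qed

end
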